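(* Given fees $c_1,\dots,c_{n-1}\ge 0$ (with the formal convention $c_n=0$) and payoffs $w_1,\dots,w_n>0$, let $W_k=\sum_{i=k}^n w_i$, $W=W_1$, and $$M = W\cdot\max_{1\le k\le n}\left(\frac{c_k}{w_k}+\sum_{i=1}^{k-1}\frac{c_i}{W_{i+1}}\right).$$ Consider the $m$-person $n$-stage game described in the context, with initial resources $A^1,\dots,A^m$ of players $P_1,\dots,P_m$. If $A^1,\dots,A^m>M$, then the $m$ strategies $\sigma^1_{n,A^1,\dots,A^m},\dots,\sigma^m_{n,A^1,\dots,A^m}$ are a unique Nash equilibrium for the $m$-person game, with expected total payoffs $$\frac{A^1W}{\sum_{i=1}^m A^i},\ \dots,\ \frac{A^mW}{\sum_{i=1}^m A^i}$$ for $P_1,\dots,P_m$ respectively. Furthermore, $\sigma^i_{n,A^1,\dots,A^m}$ guarantees the expected payoff $\frac{A^iW}{\sum_{j=1}^m A^j}$ for $P_i$ (that is, at least this expected total payoff against all strategies of the other players).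
   Context: The game. The data are: the number $n$ of stages; payoffs $w_k>0$ ($1\le k\le n$); initial resources $A^i\ge 0$ of player $P_i$, $1\le i\le m$; fees $c_k\ge 0$ ($1\le k\le n-1$), with the formal convention $c_n=0$. At stage $k$ player $P_i$ has remaining resource $A^i_k$, with $A^i_1=A^i$. At stage $k$ each player $P_i$ decides on an investment $x^i_k$ with $0\le x^i_k\le A^i_k-c_k$, or $x^i_k=0$ if $A^i_k<c_k$. (Thus investing $0$ is always allowed.) Player $P_i$ wins the stage with probability $\frac{x^i_k}{\sum_{j=1}^m x^j_k}$; if $x^i_k=0$ for all $i$ then no player wins the stage. The winner of stage $k$ receives payoff $w_k$ and pays the maintenance fee $c_k$ out of his resources: $A^i_{k+1}=A^i_k-x^i_k-c_k$ if $P_i$ wins stage $k$, and $A^i_{k+1}=A^i_k-x^i_k$ otherwise. The total payoff of a player is the sum of the $w_k$ over the stages he wins. Resources and payoffs are of different nature and cannot be interchanged. The strategy $\sigma^i_{n,A^1,\dots,A^m}$ of $P_i$: at stage $k$ with remaining resources $A^1_k,\dots,A^m_k$, let $$a^i_k=\frac{w_kA^i_k}{W_k}-\frac{A^i_kc_k}{\sum_{j=1}^m A^j_k}.$$ $P_i$ invests $a^i_k$ if that is allowed by the rules of the game, and otherwise invests $0$.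
   Formalization: Uniqueness means that every Nash equilibrium prescribes the same investments as the σ's after almost every history arising in its play (behaviour at unreached histories is not determined), and m ≥ 2 is assumed, since for m = 1 any positive investments win. *)

theory Defs
  imports "HOL-Probability.Probability"
begin

text \<open>
  The players are the elements of a finite type \<open>'p\<close>, so the number of players is \<open>CARD('p)\<close>;
  stages are numbered from 1.  The outcome of a stage is the vector of investments together with
  the winner (\<open>None\<close> if nobody wins), and \<open>h l\<close> is the outcome of stage \<open>l\<close> in the history \<open>h\<close>.
\<close>

type_synonym 'p outcome = "('p \<Rightarrow> real) \<times> 'p option"
type_synonym 'p history = "nat \<Rightarrow> 'p outcome"

text \<open>
  Strategies may depend on the whole history and may randomise: \<open>s k h\<close> is the distribution of the
  investment made at stage \<open>k\<close> after the history \<open>h\<close> of stages \<open>1, \<dots>, k - 1\<close>.  Pure strategies are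
  those all of whose values are point masses \<open>return borel x\<close>.
\<close>

type_synonym 'p strategy = "nat \<Rightarrow> 'p history \<Rightarrow> real measure"

definition outcome_space :: "'p::finite outcome measure" where
  "outcome_space = (\<Pi>\<^sub>M i\<in>UNIV. borel) \<Otimes>\<^sub>M count_space UNIV"

text \<open>The histories after \<open>k\<close> stages; stage \<open>Suc k\<close> comes next.\<close>

definition hist_space :: "nat \<Rightarrow> 'p::finite history measure" where
  "hist_space k = (\<Pi>\<^sub>M l\<in>{1..k}. outcome_space)"

text \<open>\<open>resources c A h k i\<close> is $A^i_k$, the amount left to player \<open>i\<close> at the beginning of stage
  \<open>k \<ge> 1\<close>.\<close>

definition resources ::
  "(nat \<Rightarrow> real) \<Rightarrow> ('p \<Rightarrow> real) \<Rightarrow> 'p history \<Rightarrow> nat \<Rightarrow> 'p \<Rightarrow> real" where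
  "resources c A h k i =
     A i - (\<Sum>l\<in>{1..<k}. fst (h l) i + (if snd (h l) = Some i then c l else 0))"

lemma resources_first: "resources c A h 1 i = A i"
  by (simp add: resources_def)

lemma resources_next:
  assumes "k \<ge> 1"
  shows "resources c A h (Suc k) i =
    (if snd (h k) = Some i then resources c A h k i - fst (h k) i - c k
     else resources c A h k i - fst (h k) i)"
  using assms by (simp add: resources_def)

definition legal_investment :: "real \<Rightarrow> real \<Rightarrow> real \<Rightarrow> bool" where
  "legal_investment fee a x \<longleftrightarrow> (if a < fee then x = 0 else 0 \<le> x \<and> x \<le> a - fee)"

text \<open>Vectors with a negative entry are never legal; they are included in the second case only to
  have a distribution for every vector.\<close>

definition winner_pmf :: "('p::finite \<Rightarrow> real) \<Rightarrow> 'p option pmf" where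
  "winner_pmf x =
     (if (\<forall>j. 0 \<le> x j) \<and> (\<exists>j. x j \<noteq> 0)
      then embed_pmf (\<lambda>r. case r of None \<Rightarrow> 0 | Some i \<Rightarrow> x i / (\<Sum>j\<in>UNIV. x j))
      else return_pmf None)"

lemma pmf_winner_pmf:
  fixes x :: "'p::finite \<Rightarrow> real"
  assumes nonneg: "\<forall>j. 0 \<le> x j" and nz: "\<exists>j. x j \<noteq> 0"
  shows "pmf (winner_pmf x) (Some i) = x i / (\<Sum>j\<in>UNIV. x j)"
    and "pmf (winner_pmf x) None = 0"
proof -
  let ?f = "\<lambda>r. case r of None \<Rightarrow> 0 | Some i \<Rightarrow> x i / (\<Sum>j\<in>UNIV. x j)"
  have pos: "(\<Sum>j\<in>UNIV. x j) > 0"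
    using nonneg nz by (metis UNIV_I finite less_eq_real_def sum_pos2)
  have f0: "\<And>r. 0 \<le> ?f r"
    using nonneg pos by (auto split: option.splits)
  have "(\<Sum>r\<in>UNIV. ?f r) = (\<Sum>j\<in>UNIV. x j / (\<Sum>j\<in>UNIV. x j))"
    by (simp add: UNIV_option_conv sum.reindex)
  also have "\<dots> = 1"
    using pos by (simp add: sum_divide_distrib[symmetric])
  finally have "(\<integral>\<^sup>+r. ennreal (?f r) \<partial>count_space UNIV) = 1"
    using f0 by (simp add: nn_integral_count_space_finite sum_ennreal)
  then have "pmf (embed_pmf ?f) r = ?f r" for r
    by (rule pmf_embed_pmf[OF f0])
  then show "pmf (winner_pmf x) (Some i) = x i / (\<Sum>j\<in>UNIV. x j)"
    and "pmf (winner_pmf x) None = 0"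
    using nonneg nz by (auto simp: winner_pmf_def)
qed

definition admissible ::
  "nat \<Rightarrow> (nat \<Rightarrow> real) \<Rightarrow> ('p::finite \<Rightarrow> real) \<Rightarrow> 'p \<Rightarrow> 'p strategy \<Rightarrow> bool" where
  "admissible n c A i s \<longleftrightarrow>
     (\<forall>k<n. s (Suc k) \<in> hist_space k \<rightarrow>\<^sub>M prob_algebra borel \<and>
       (\<forall>h\<in>space (hist_space k).
         AE x in s (Suc k) h. legal_investment (c (Suc k)) (resources c A h (Suc k) i) x))"

text \<open>In each stage the players choose their investments independently given the history.\<close>

definition stage_law ::
  "('p::finite \<Rightarrow> 'p strategy) \<Rightarrow> nat \<Rightarrow> 'p history \<Rightarrow> 'p outcome measure" where
  "stage_law s k h =
     (\<Pi>\<^sub>M i\<in>UNIV. s i k h) \<bind>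
       (\<lambda>x. distr (measure_pmf (winner_pmf x)) outcome_space (\<lambda>r. (x, r)))"

text \<open>\<open>play_law s k\<close> is the distribution of the history of the first \<open>k\<close> stages.\<close>

primrec play_law :: "('p::finite \<Rightarrow> 'p strategy) \<Rightarrow> nat \<Rightarrow> 'p history measure" where
  "play_law s 0 = return (hist_space 0) (\<lambda>_. undefined)"
| "play_law s (Suc k) =
     play_law s k \<bind>
       (\<lambda>h. distr (stage_law s (Suc k) h) (hist_space (Suc k)) (\<lambda>z. h(Suc k := z)))"

definition total_payoff :: "nat \<Rightarrow> (nat \<Rightarrow> real) \<Rightarrow> 'p history \<Rightarrow> 'p \<Rightarrow> real" where
  "total_payoff n w h i = (\<Sum>k\<in>{1..n}. if snd (h k) = Some i then w k else 0)"

definition expected_payoff ::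
  "nat \<Rightarrow> (nat \<Rightarrow> real) \<Rightarrow> ('p::finite \<Rightarrow> 'p strategy) \<Rightarrow> 'p \<Rightarrow> real" where
  "expected_payoff n w s i = (\<integral>h. total_payoff n w h i \<partial>play_law s n)"

definition nash_equilibrium ::
  "nat \<Rightarrow> (nat \<Rightarrow> real) \<Rightarrow> (nat \<Rightarrow> real) \<Rightarrow> ('p::finite \<Rightarrow> real) \<Rightarrow> ('p \<Rightarrow> 'p strategy) \<Rightarrow> bool" where
  "nash_equilibrium n w c A s \<longleftrightarrow>
     (\<forall>i. admissible n c A i (s i)) \<and>
     (\<forall>i t. admissible n c A i t \<longrightarrow>
        expected_payoff n w (s(i := t)) i \<le> expected_payoff n w s i)"

text \<open>
  Two profiles of strategies are identified if they prescribe the same behaviour after almost every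
  history that arises in the play.  What a strategy prescribes at other histories, for instance
  after a deviation by the player himself, is not determined by the equilibrium condition, so that
  literal equality of functions cannot be expected.
\<close>

definition agree_in_play :: "nat \<Rightarrow> ('p::finite \<Rightarrow> 'p strategy) \<Rightarrow> ('p \<Rightarrow> 'p strategy) \<Rightarrow> bool" where
  "agree_in_play n s t \<longleftrightarrow>
     (\<forall>k<n. AE h in play_law s k. \<forall>i. s i (Suc k) h = t i (Suc k) h)"

definition unique_nash_equilibrium ::
  "nat \<Rightarrow> (nat \<Rightarrow> real) \<Rightarrow> (nat \<Rightarrow> real) \<Rightarrow> ('p::finite \<Rightarrow> real) \<Rightarrow> ('p \<Rightarrow> 'p strategy) \<Rightarrow> bool" where
  "unique_nash_equilibrium n w c A s \<longleftrightarrow>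
     nash_equilibrium n w c A s \<and>
     (\<forall>t. nash_equilibrium n w c A t \<longrightarrow> agree_in_play n t s)"

definition tail_payoff :: "nat \<Rightarrow> (nat \<Rightarrow> real) \<Rightarrow> nat \<Rightarrow> real" where
  "tail_payoff n w k = (\<Sum>i=k..n. w i)"

definition threshold :: "nat \<Rightarrow> (nat \<Rightarrow> real) \<Rightarrow> (nat \<Rightarrow> real) \<Rightarrow> real" where
  "threshold n w c =
     tail_payoff n w 1 *
       Max ((\<lambda>k. c k / w k + (\<Sum>i\<in>{1..<k}. c i / tail_payoff n w (Suc i))) ` {1..n})"

definition sigma_investment ::
  "nat \<Rightarrow> (nat \<Rightarrow> real) \<Rightarrow> (nat \<Rightarrow> real) \<Rightarrow> ('p::finite \<Rightarrow> real) \<Rightarrow> 'p \<Rightarrow> nat \<Rightarrow> 'p history \<Rightarrow> real" where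
  "sigma_investment n w c A i k h =
     (let R = resources c A h k;
          a = w k * R i / tail_payoff n w k - R i * c k / (\<Sum>j\<in>UNIV. R j)
      in if legal_investment (c k) (R i) a then a else 0)"

definition sigma_strategy ::
  "nat \<Rightarrow> (nat \<Rightarrow> real) \<Rightarrow> (nat \<Rightarrow> real) \<Rightarrow> ('p::finite \<Rightarrow> real) \<Rightarrow> 'p \<Rightarrow> 'p strategy" where
  "sigma_strategy n w c A i k h = return borel (sigma_investment n w c A i k h)"

end

theory Submission
  imports Defs
begin

text \<open>
  Let player $P_i$ use \<open>\<sigma>\<close> while the others do anything legal, and follow
  the quantity ``payoff collected so far plus $W_k$ times the share of $P_i$ in the resources''. At
  stage \<open>k\<close>, with own resources \<open>R\<close>, total resources \<open>T\<close> and total investment \<open>z\<close>, its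
  expected increase is
  \[ \frac{W_k R\,(w_k T / W_k - c_k - z)^2}{T z (T - c_k - z)} \ge 0 \]
  (\<open>stage_value_identity\<close>, \<open>stage_value\<close>). The threshold guarantees that $P_i$ can afford the
  prescribed bids throughout: a player above the threshold of the current stage bids a positive legal
  amount and is above the threshold of the next stage whoever wins (\<open>proportional_bid_safe\<close>).
  So the quantity is a submartingale that starts at $A^i W / \sum_j A^j$ and ends at the payoff of
  $P_i$, which is the guarantee (\<open>expected_payoff_ge_share\<close>).

  The guaranteed payoffs add up to \<open>W\<close>, and no profile distributes more than \<open>W\<close>. Hence if
  all players use \<open>\<sigma>\<close>, each gets exactly his guaranteed payoff, and a deviating player gets at
  most his own because the others still get theirs (\<open>nash_sigma\<close>).

  For uniqueness, let \<open>t\<close> be any equilibrium. By the same count each $P_i$ gets exactly the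
  guaranteed payoff, also if he alone switches to \<open>\<sigma>\<close> (\<open>nash_tight\<close>). In the play after that
  switch the submartingale is therefore a martingale, all squares vanish, and the total investment
  is $w_k T / W_k - c_k$ almost surely (\<open>tight_total_investment\<close>). As this is also the sum of all
  proportional bids, the opponents of $P_i$ together invest the sum of their proportional bids. This
  holds for every \<open>i\<close>, so with at least two players everybody invests his proportional bid
  (\<open>investments_determined\<close>). The switch does not change the law of play up to stage \<open>k\<close> if
  \<open>t\<close> agrees with \<open>\<sigma>\<close> before stage \<open>k\<close>, and induction on the stage completes the proof
  (\<open>nash_agrees_with_sigma\<close>).
\<close>

section \<open>The law of play as an iterated kernel\<close>

text \<open>
  It is enough to test a product kernel on measurable boxes: they are stable under intersection and
  generate the product $\sigma$-algebra, and the mass of a box is a finite product of measurable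
  functions.
\<close>

lemma measurable_PiM_kernel:
  fixes K :: "'i::finite \<Rightarrow> 'a \<Rightarrow> 'b measure"
  assumes K: "\<And>i. K i \<in> M \<rightarrow>\<^sub>M prob_algebra (L i)"
  shows "(\<lambda>a. \<Pi>\<^sub>M i\<in>UNIV. K i a) \<in> M \<rightarrow>\<^sub>M prob_algebra (\<Pi>\<^sub>M i\<in>UNIV. L i)"
proof (rule measurable_prob_algebra_generated[OF sets_PiM Int_stable_prod_algebra
        prod_algebra_sets_into_space])
  fix a assume a: "a \<in> space M"
  have p: "prob_space (K i a)" and s: "sets (K i a) = sets (L i)" for i
    using measurable_space[OF K a] by (auto simp: space_prob_algebra)
  show "prob_space (\<Pi>\<^sub>M i\<in>UNIV. K i a)"
    by (intro prob_space_PiM p)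
  show "sets (\<Pi>\<^sub>M i\<in>UNIV. K i a) = sets (\<Pi>\<^sub>M i\<in>UNIV. L i)"
    by (intro sets_PiM_cong s refl)
next
  fix B assume "B \<in> prod_algebra UNIV L"
  then obtain X where B: "B = Pi\<^sub>E UNIV X" and X: "\<And>i. X i \<in> sets (L i)"
    by (auto simp: prod_algebra_eq_finite)
  have "(\<lambda>a. \<Prod>i\<in>UNIV. emeasure (K i a) (X i)) \<in> borel_measurable M"
    using measurable_emeasure_kernel[OF measurable_prob_algebraD[OF K] X] by measurable
  then show "(\<lambda>a. emeasure (\<Pi>\<^sub>M i\<in>UNIV. K i a) B) \<in> borel_measurable M"
  proof (rule measurable_cong[THEN iffD1, rotated])
    fix a assume a: "a \<in> space M"
    have p: "prob_space (K i a)" and s: "sets (K i a) = sets (L i)" for i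
      using measurable_space[OF K a] by (auto simp: space_prob_algebra)
    interpret product_sigma_finite "\<lambda>i. K i a"
      using p by (simp add: product_sigma_finite_def prob_space_imp_sigma_finite)
    show "(\<Prod>i\<in>UNIV. emeasure (K i a) (X i)) = emeasure (\<Pi>\<^sub>M i\<in>UNIV. K i a) B"
      unfolding B by (rule emeasure_PiM[symmetric]) (simp_all add: X s)
  qed
qed

lemma winner_pmf_eq:
  fixes x :: "'p::finite \<Rightarrow> real"
  shows "pmf (winner_pmf x) r =
     (if (\<forall>j. 0 \<le> x j) \<and> (\<exists>j. x j \<noteq> 0)
      then (case r of None \<Rightarrow> 0 | Some i \<Rightarrow> x i / (\<Sum>j\<in>UNIV. x j))
      else of_bool (r = None))"
proof (cases "(\<forall>j. 0 \<le> x j) \<and> (\<exists>j. x j \<noteq> 0)")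
  case True
  then show ?thesis
    using pmf_winner_pmf[of x] by (auto split: option.split)
next
  case False
  then show ?thesis by (auto simp: winner_pmf_def indicator_def)
qed

lemma measurable_winner_pmf:
  "(\<lambda>x. measure_pmf (winner_pmf x))
     \<in> (\<Pi>\<^sub>M i\<in>UNIV. borel) \<rightarrow>\<^sub>M prob_algebra (count_space (UNIV :: 'p::finite option set))"
proof (rule measurable_prob_algebra_generated[where G = UNIV and \<Omega> = UNIV])
  have m: "(\<lambda>x :: 'p \<Rightarrow> real. pmf (winner_pmf x) r) \<in> borel_measurable (\<Pi>\<^sub>M i\<in>UNIV. borel)" for r
    unfolding winner_pmf_eq
  proof (intro measurable_If)
    have m: "(\<lambda>x :: 'p \<Rightarrow> real. \<Sum>j\<in>UNIV. x j) \<in> borel_measurable (\<Pi>\<^sub>M i\<in>UNIV. borel)"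
      by (intro borel_measurable_sum measurable_component_singleton) simp
    show "(\<lambda>x :: 'p \<Rightarrow> real. case r of None \<Rightarrow> 0 | Some i \<Rightarrow> x i / (\<Sum>j\<in>UNIV. x j))
        \<in> borel_measurable (\<Pi>\<^sub>M i\<in>UNIV. borel)"
    proof (cases r)
      case (Some i)
      have "(\<lambda>x :: 'p \<Rightarrow> real. x i / (\<Sum>j\<in>UNIV. x j)) \<in> borel_measurable (\<Pi>\<^sub>M i\<in>UNIV. borel)"
        by (rule borel_measurable_divide[OF _ m]) simp
      then show ?thesis by (simp add: Some)
    qed simp
  qed simp_all
  fix B :: "'p option set"
  have "emeasure (measure_pmf (winner_pmf x)) B = ennreal (\<Sum>r\<in>B. pmf (winner_pmf x) r)"
    for x :: "'p \<Rightarrow> real"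
    by (simp add: emeasure_measure_pmf_finite)
  then show "(\<lambda>x. emeasure (measure_pmf (winner_pmf x)) B) \<in> borel_measurable (\<Pi>\<^sub>M i\<in>UNIV. borel)"
    using m by simp
qed (auto simp: Int_stable_def prob_space_measure_pmf intro: sigma_sets.Basic)

definition winner_kernel :: "('p::finite \<Rightarrow> real) \<Rightarrow> 'p outcome measure" where
  "winner_kernel x = distr (measure_pmf (winner_pmf x)) outcome_space (\<lambda>r. (x, r))"

lemma measurable_winner_kernel:
  "winner_kernel \<in> (\<Pi>\<^sub>M i\<in>UNIV. borel) \<rightarrow>\<^sub>M prob_algebra outcome_space"
  unfolding winner_kernel_def[abs_def]
  by (rule measurable_distr_prob_space2[OF measurable_winner_pmf])
     (simp add: outcome_space_def)

definition measurable_profile :: "nat \<Rightarrow> ('p::finite \<Rightarrow> 'p strategy) \<Rightarrow> bool" where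
  "measurable_profile n s \<longleftrightarrow>
     (\<forall>i. \<forall>k<n. s i (Suc k) \<in> hist_space k \<rightarrow>\<^sub>M prob_algebra borel)"

definition joint_law :: "('p::finite \<Rightarrow> 'p strategy) \<Rightarrow> nat \<Rightarrow> 'p history \<Rightarrow> ('p \<Rightarrow> real) measure" where
  "joint_law s k h = (\<Pi>\<^sub>M i\<in>UNIV. s i k h)"

lemma stage_law_eq: "stage_law s k h = joint_law s k h \<bind> winner_kernel"
  by (simp add: stage_law_def joint_law_def winner_kernel_def[abs_def])

lemma measurable_joint_law:
  assumes "measurable_profile n s" "k < n"
  shows "joint_law s (Suc k) \<in> hist_space k \<rightarrow>\<^sub>M prob_algebra (\<Pi>\<^sub>M i\<in>UNIV. borel)"
  unfolding joint_law_def[abs_def]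
  by (rule measurable_PiM_kernel) (use assms in \<open>auto simp: measurable_profile_def\<close>)

lemma
  assumes "measurable_profile n s" "k < n" "h \<in> space (hist_space k)"
  shows prob_space_joint_law: "prob_space (joint_law s (Suc k) h)"
    and sets_joint_law: "sets (joint_law s (Suc k) h) = sets (\<Pi>\<^sub>M i\<in>UNIV. borel)"
  using measurable_space[OF measurable_joint_law[OF assms(1,2)] assms(3)]
  by (auto simp: space_prob_algebra)

lemma measurable_stage_law:
  assumes "measurable_profile n s" "k < n"
  shows "stage_law s (Suc k) \<in> hist_space k \<rightarrow>\<^sub>M prob_algebra outcome_space"
  unfolding stage_law_eq[abs_def]
  by (rule measurable_bind_prob_space[OF measurable_joint_law[OF assms] measurable_winner_kernel])

lemma measurable_extend_history:
  "(\<lambda>(h, z). h(Suc k := z)) \<in> hist_space k \<Otimes>\<^sub>M outcome_space \<rightarrow>\<^sub>M hist_space (Suc k)"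
  using measurable_add_dim[of "Suc k" "{1..k}" "\<lambda>_. outcome_space"]
  by (simp add: hist_space_def atLeastAtMostSuc_conv)

definition step_kernel :: "('p::finite \<Rightarrow> 'p strategy) \<Rightarrow> nat \<Rightarrow> 'p history \<Rightarrow> 'p history measure" where
  "step_kernel s k h = distr (stage_law s (Suc k) h) (hist_space (Suc k)) (\<lambda>z. h(Suc k := z))"

lemma measurable_step_kernel:
  assumes "measurable_profile n s" "k < n"
  shows "step_kernel s k \<in> hist_space k \<rightarrow>\<^sub>M prob_algebra (hist_space (Suc k))"
  unfolding step_kernel_def[abs_def]
  by (rule measurable_distr_prob_space2[OF measurable_stage_law[OF assms]])
     (rule measurable_extend_history)

lemma play_law_Suc_eq: "play_law s (Suc k) = play_law s k \<bind> step_kernel s k"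
  by (simp add: step_kernel_def[abs_def])

lemma play_law_in_space:
  assumes "measurable_profile n s" "k \<le> n"
  shows "play_law s k \<in> space (prob_algebra (hist_space k))"
  using assms(2)
proof (induction k)
  case 0
  show ?case
    by (auto simp: space_prob_algebra hist_space_def space_PiM intro!: prob_space_return)
next
  case (Suc k)
  then have IH: "play_law s k \<in> space (prob_algebra (hist_space k))" by simp
  have m: "step_kernel s k \<in> hist_space k \<rightarrow>\<^sub>M prob_algebra (hist_space (Suc k))"
    using Suc by (intro measurable_step_kernel[OF assms(1)]) simp
  show ?case
    unfolding play_law_Suc_eq space_prob_algebra
    using prob_space_bind'[OF IH m] sets_bind'[OF IH m] by simp
qed

lemma sets_play_law:
  assumes "measurable_profile n s" "k \<le> n"
  shows "sets (play_law s k) = sets (hist_space k)"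
  using play_law_in_space[OF assms] by (simp add: space_prob_algebra)

lemma prob_space_play_law:
  assumes "measurable_profile n s" "k \<le> n"
  shows "prob_space (play_law s k)"
  using play_law_in_space[OF assms] by (simp add: space_prob_algebra)

lemma space_play_law:
  assumes "measurable_profile n s" "k \<le> n"
  shows "space (play_law s k) = space (hist_space k)"
  using sets_play_law[OF assms] by (rule sets_eq_imp_space_eq)

lemma measurable_extend_history_at:
  "h \<in> space (hist_space k) \<Longrightarrow>
     (\<lambda>z. h(Suc k := z)) \<in> outcome_space \<rightarrow>\<^sub>M hist_space (Suc k)"
  using measurable_Pair2[OF measurable_extend_history, of h k] by simp

lemma measurable_outcome_Pair: "x \<in> space (\<Pi>\<^sub>M i\<in>UNIV. borel) \<Longrightarrow>
   (\<lambda>r. (x, r)) \<in> measure_pmf p \<rightarrow>\<^sub>M outcome_space"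
  unfolding outcome_space_def by (simp add: space_pair_measure)

text \<open>
  Once the investments are drawn, the rest of the stage is a draw from a finite set, so one round of
  the play is an integral over investment vectors of a finite sum over winners. All computations
  below go through this formula and its almost-everywhere counterpart.
\<close>

lemma nn_integral_step_kernel:
  fixes s :: "'p::finite \<Rightarrow> 'p strategy"
  assumes s: "measurable_profile n s" "k < n" and h: "h \<in> space (hist_space k)"
    and f: "f \<in> borel_measurable (hist_space (Suc k))"
  shows "(\<integral>\<^sup>+h'. f h' \<partial>step_kernel s k h) =
    (\<integral>\<^sup>+x. (\<Sum>r\<in>UNIV. ennreal (pmf (winner_pmf x) r) * f (h(Suc k := (x, r)))) \<partial>joint_law s (Suc k) h)"
proof -
  have Js: "sets (joint_law s (Suc k) h) = sets (\<Pi>\<^sub>M i\<in>UNIV. borel)"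
    by (rule sets_joint_law[OF s h])
  have S: "sets (stage_law s (Suc k) h) = sets outcome_space"
    using measurable_space[OF measurable_stage_law[OF s] h] by (simp add: space_prob_algebra)
  have e: "(\<lambda>z. h(Suc k := z)) \<in> outcome_space \<rightarrow>\<^sub>M hist_space (Suc k)"
    by (rule measurable_extend_history_at[OF h])
  then have fe: "(\<lambda>z. f (h(Suc k := z))) \<in> borel_measurable outcome_space"
    by (rule measurable_compose) (rule f)
  have K: "winner_kernel \<in> joint_law s (Suc k) h \<rightarrow>\<^sub>M subprob_algebra outcome_space"
    using measurable_prob_algebraD[OF measurable_winner_kernel] Js
    by (simp cong: measurable_cong_sets)
  have "(\<integral>\<^sup>+h'. f h' \<partial>step_kernel s k h) = (\<integral>\<^sup>+z. f (h(Suc k := z)) \<partial>stage_law s (Suc k) h)"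
    unfolding step_kernel_def
    by (rule nn_integral_distr) (use e S f in \<open>simp_all cong: measurable_cong_sets\<close>)
  also have "\<dots> = (\<integral>\<^sup>+x. \<integral>\<^sup>+z. f (h(Suc k := z)) \<partial>winner_kernel x \<partial>joint_law s (Suc k) h)"
    unfolding stage_law_eq by (rule nn_integral_bind[OF fe K])
  also have "\<dots> = (\<integral>\<^sup>+x. (\<Sum>r\<in>UNIV. ennreal (pmf (winner_pmf x) r) * f (h(Suc k := (x, r))))
      \<partial>joint_law s (Suc k) h)"
  proof (rule nn_integral_cong)
    fix x assume "x \<in> space (joint_law s (Suc k) h)"
    then have x: "x \<in> space (\<Pi>\<^sub>M i\<in>UNIV. borel)"
      using sets_eq_imp_space_eq[OF Js] by simp
    have "(\<integral>\<^sup>+z. f (h(Suc k := z)) \<partial>winner_kernel x)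
        = (\<integral>\<^sup>+r. f (h(Suc k := (x, r))) \<partial>measure_pmf (winner_pmf x))"
      unfolding winner_kernel_def
      by (subst nn_integral_distr[OF measurable_outcome_Pair[OF x]]) (simp_all add: fe)
    also have "\<dots> = (\<Sum>r\<in>UNIV. ennreal (pmf (winner_pmf x) r) * f (h(Suc k := (x, r))))"
      by (simp add: nn_integral_measure_pmf nn_integral_count_space_finite)
    finally show "(\<integral>\<^sup>+z. f (h(Suc k := z)) \<partial>winner_kernel x) =
      (\<Sum>r\<in>UNIV. ennreal (pmf (winner_pmf x) r) * f (h(Suc k := (x, r))))" .
  qed
  finally show ?thesis .
qed

lemma AE_step_kernel:
  fixes s :: "'p::finite \<Rightarrow> 'p strategy"
  assumes s: "measurable_profile n s" "k < n" and h: "h \<in> space (hist_space k)"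
    and P: "Measurable.pred (hist_space (Suc k)) P"
    and "AE x in joint_law s (Suc k) h. \<forall>r\<in>set_pmf (winner_pmf x). P (h(Suc k := (x, r)))"
  shows "AE h' in step_kernel s k h. P h'"
proof -
  have Js: "sets (joint_law s (Suc k) h) = sets (\<Pi>\<^sub>M i\<in>UNIV. borel)"
    by (rule sets_joint_law[OF s h])
  have S: "sets (stage_law s (Suc k) h) = sets outcome_space"
    using measurable_space[OF measurable_stage_law[OF s] h] by (simp add: space_prob_algebra)
  have e: "(\<lambda>z. h(Suc k := z)) \<in> outcome_space \<rightarrow>\<^sub>M hist_space (Suc k)"
    by (rule measurable_extend_history_at[OF h])
  then have pe: "Measurable.pred outcome_space (\<lambda>z. P (h(Suc k := z)))"
    by (rule measurable_compose) (rule P)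
  have K: "winner_kernel \<in> joint_law s (Suc k) h \<rightarrow>\<^sub>M subprob_algebra outcome_space"
    using measurable_prob_algebraD[OF measurable_winner_kernel] Js
    by (simp cong: measurable_cong_sets)
  have "AE x in joint_law s (Suc k) h. AE z in winner_kernel x. P (h(Suc k := z))"
    using assms(5)
  proof (rule AE_mp[OF _ AE_I2[OF impI]])
    fix x assume "x \<in> space (joint_law s (Suc k) h)"
      and *: "\<forall>r\<in>set_pmf (winner_pmf x). P (h(Suc k := (x, r)))"
    then have x: "x \<in> space (\<Pi>\<^sub>M i\<in>UNIV. borel)"
      using sets_eq_imp_space_eq[OF Js] by simp
    show "AE z in winner_kernel x. P (h(Suc k := z))"
      unfolding winner_kernel_def
      using * pe
      by (subst AE_distr_iff[OF measurable_outcome_Pair[OF x]])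
         (auto simp: AE_measure_pmf_iff pred_def)
  qed
  then have "AE z in stage_law s (Suc k) h. P (h(Suc k := z))"
    unfolding stage_law_eq by (subst AE_bind[OF K pe])
  then show ?thesis
    unfolding step_kernel_def using e S P
    by (subst AE_distr_iff) (auto simp: pred_def cong: measurable_cong_sets)
qed

lemma step_kernel_measurable_play_law:
  assumes "measurable_profile n s" "k < n"
  shows "step_kernel s k \<in> play_law s k \<rightarrow>\<^sub>M subprob_algebra (hist_space (Suc k))"
  using measurable_prob_algebraD[OF measurable_step_kernel[OF assms]]
    sets_play_law[OF assms(1), of k] assms(2)
  by (simp cong: measurable_cong_sets)

lemma nn_integral_play_law_Suc:
  fixes s :: "'p::finite \<Rightarrow> 'p strategy"
  assumes "measurable_profile n s" "k < n" "f \<in> borel_measurable (hist_space (Suc k))"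
  shows "(\<integral>\<^sup>+h. f h \<partial>play_law s (Suc k)) = (\<integral>\<^sup>+h. \<integral>\<^sup>+h'. f h' \<partial>step_kernel s k h \<partial>play_law s k)"
  unfolding play_law_Suc_eq
  by (rule nn_integral_bind[OF assms(3) step_kernel_measurable_play_law[OF assms(1,2)]])

lemma AE_play_law_Suc:
  fixes s :: "'p::finite \<Rightarrow> 'p strategy"
  assumes s: "measurable_profile n s" "k < n" and P: "Measurable.pred (hist_space (Suc k)) P"
    and AE: "AE h in play_law s k. AE x in joint_law s (Suc k) h.
          \<forall>r\<in>set_pmf (winner_pmf x). P (h(Suc k := (x, r)))"
  shows "AE h in play_law s (Suc k). P h"
  unfolding play_law_Suc_eq
proof (subst AE_bind[OF step_kernel_measurable_play_law[OF s] P])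
  show "AE h in play_law s k. AE h' in step_kernel s k h. P h'"
    using AE
  proof (rule AE_mp[OF _ AE_I2[OF impI]])
    fix h assume "h \<in> space (play_law s k)"
      and "AE x in joint_law s (Suc k) h. \<forall>r\<in>set_pmf (winner_pmf x). P (h(Suc k := (x, r)))"
    then show "AE h' in step_kernel s k h. P h'"
      using s space_play_law[OF s(1), of k] by (intro AE_step_kernel[OF s _ P]) auto
  qed
qed

text \<open>
  Changing strategies off the path of play does not change the law of play. The induction that proves
  uniqueness uses this to transfer statements between an equilibrium and its unilateral deviations.
\<close>

lemma play_law_cong:
  assumes s: "measurable_profile n s" and t: "measurable_profile n t"
    and "k \<le> n" and "\<forall>l<k. AE h in play_law s l. \<forall>i. s i (Suc l) h = t i (Suc l) h"
  shows "play_law s k = play_law t k"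
  using assms(3,4)
proof (induction k)
  case (Suc k)
  then have eq: "play_law s k = play_law t k" by simp
  have "AE h in play_law t k. step_kernel s k h = step_kernel t k h"
    using Suc.prems(2)[rule_format, OF lessI, unfolded eq]
    by (rule AE_mp, intro AE_I2 impI) (simp add: step_kernel_def stage_law_eq joint_law_def)
  then show ?case
    unfolding play_law_Suc_eq using Suc.prems eq
      step_kernel_measurable_play_law[OF s, of k] step_kernel_measurable_play_law[OF t, of k]
    by (intro bind_cong_AE[OF eq]) auto
qed simp

section \<open>The expected value of one stage\<close>

text \<open>
  This is the computation behind the theorem. Here \<open>R\<close> and \<open>T\<close> are the resources of one player
  and of all players, \<open>W\<close> is the payoff still at stake, \<open>w\<close> and \<open>c\<close> are payoff and fee of the
  current stage, and \<open>z\<close> is the total investment. The left-hand side is what the player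
  expects if he bids \<open>a\<close> and the play is worth his share of the resources afterwards: with
  probability $a/z$ he wins \<open>w\<close> and pays \<open>c\<close>, otherwise somebody else does, and either way
  $T - c - z$ is left in total. The only influence of the opponents is through \<open>z\<close>, and it
  enters through a square: as long as $T - c - z \ge 0$, the value is at least $WR/T$.

  In the last stage $W = w$ and $c = 0$, and all resources may be spent, so that $T - c - z = 0$.
  Division by zero then yields 0 on both sides, in agreement with the value of the game.
\<close>

lemma stage_value_identity:
  fixes R T W w c a z :: real
  assumes pos: "0 < T" "0 < W" "0 < z"
    and last: "T - c - z = 0 \<Longrightarrow> W = w \<and> c = 0"
    and a: "a = w * R / W - R * c / T"
  shows "a / z * (w + (W - w) * (R - a - c) / (T - c - z)) +
      (z - a) / z * ((W - w) * (R - a) / (T - c - z)) =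
    W * R / T + R * (w * T / W - c - z)\<^sup>2 * W / (T * z * (T - c - z))"
proof (cases "T - c - z = 0")
  case True
  with last[OF True] pos a show ?thesis by (simp add: field_simps)
next
  case False
  \<comment> \<open>In terms of the fraction \<open>u\<close> of the remaining payoff and of the optimal total investment \<open>q\<close>,
    all denominators separate and a polynomial identity remains.\<close>
  define y where "y = T - c - z"
  define u where "u = w / W"
  define q where "q = u * T - c"
  have y: "y \<noteq> 0" using False by (simp add: y_def)
  have w: "w = u * W" using pos by (simp add: u_def)
  have aq: "a = R * q / T" using pos by (simp add: a q_def w field_simps)
  have poly: "q * u * y + (1 - u) * (z * (T - q) - q * c) = z * y + (q - z)\<^sup>2"
    unfolding q_def y_def by (simp add: algebra_simps power2_eq_square)
  have "a / z * (w + (W - w) * (R - a - c) / y) + (z - a) / z * ((W - w) * (R - a) / y)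
      = (a * w * y + (W - w) * (z * (R - a) - a * c)) / (z * y)"
    using pos y by (simp add: field_simps)
  also have "a * w * y + (W - w) * (z * (R - a) - a * c)
      = W * R / T * (q * u * y + (1 - u) * (z * (T - q) - q * c))"
    unfolding w aq using pos by (simp add: field_simps)
  also have "\<dots> / (z * y) = W * R / T + R * (q - z)\<^sup>2 * W / (T * z * y)"
    unfolding poly using pos y by (simp add: field_simps)
  finally show ?thesis
    using pos by (simp add: y_def q_def u_def mult.commute)
qed

lemma le_sum_of_nonneg:
  fixes f :: "'a::finite \<Rightarrow> real"
  assumes "\<forall>j. 0 \<le> f j"
  shows "f i \<le> (\<Sum>j\<in>UNIV. f j)"
  by (rule member_le_sum) (use assms in auto)

lemma legal_investment_bounds:
  assumes "legal_investment f a x" "0 \<le> f" "0 \<le> a"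
  shows "0 \<le> x" "x \<le> a" "x \<noteq> 0 \<Longrightarrow> x + f \<le> a"
  using assms by (auto simp: legal_investment_def split: if_splits)

locale fee_game =
  fixes n :: nat and w c :: "nat \<Rightarrow> real" and A :: "'p::finite \<Rightarrow> real"
  assumes n_pos: "1 \<le> n"
    and w_pos: "1 \<le> k \<Longrightarrow> k \<le> n \<Longrightarrow> 0 < w k"
    and c_nonneg: "1 \<le> k \<Longrightarrow> k \<le> n \<Longrightarrow> 0 \<le> c k"
    and c_last: "c n = 0"
    and above_threshold: "threshold n w c < A i"
begin

abbreviation tail :: "nat \<Rightarrow> real" where
  "tail \<equiv> tail_payoff n w"

lemma tail_Suc: "k \<le> n \<Longrightarrow> tail k = w k + tail (Suc k)"
  by (simp add: tail_payoff_def sum.atLeast_Suc_atMost)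

lemma tail_past_end: "tail (Suc n) = 0"
  by (simp add: tail_payoff_def)

lemma tail_pos: "1 \<le> k \<Longrightarrow> k \<le> n \<Longrightarrow> 0 < tail k"
  unfolding tail_payoff_def by (rule sum_pos) (auto intro: w_pos)

lemma tail_nonneg: "1 \<le> k \<Longrightarrow> 0 \<le> tail k"
  unfolding tail_payoff_def by (rule sum_nonneg) (simp add: less_imp_le w_pos)

text \<open>
  The threshold of the game that starts at stage \<open>k\<close>, with the maximum spelled out; for \<open>k = 1\<close>
  it is the one in the theorem, see \<open>safe_initial\<close>. The predicate holds vacuously after the last
  stage.
\<close>

definition safe :: "nat \<Rightarrow> real \<Rightarrow> bool" where
  "safe k r \<longleftrightarrow> (\<forall>l\<in>{k..n}. tail k * (c l / w l + (\<Sum>i\<in>{k..<l}. c i / tail (Suc i))) < r)"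

lemma safe_initial: "safe 1 (A i)"
  unfolding safe_def
proof
  fix l assume l: "l \<in> {1..n}"
  let ?f = "\<lambda>k. c k / w k + (\<Sum>i\<in>{1..<k}. c i / tail (Suc i))"
  have "?f l \<le> Max (?f ` {1..n})"
    by (rule Max_ge[OF finite_imageI[OF finite_atLeastAtMost] imageI[OF l]])
  then have "tail 1 * ?f l \<le> threshold n w c"
    unfolding threshold_def by (rule mult_left_mono) (simp add: tail_nonneg)
  then show "tail 1 * ?f l < A i"
    using above_threshold[of i] by linarith
qed

lemma safe_mono:
  assumes "safe k r" "r \<le> r'"
  shows "safe k r'"
  unfolding safe_def
proof
  fix l assume "l \<in> {k..n}"
  with assms(1) have "tail k * (c l / w l + (\<Sum>i\<in>{k..<l}. c i / tail (Suc i))) < r"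
    unfolding safe_def by (rule bspec)
  then show "tail k * (c l / w l + (\<Sum>i\<in>{k..<l}. c i / tail (Suc i))) < r'"
    using assms(2) by (rule less_le_trans)
qed

lemma safe_covers_fee:
  assumes "safe k r" "1 \<le> k" "k \<le> n"
  shows "tail k * c k / w k < r"
proof -
  have "tail k * (c k / w k + (\<Sum>i\<in>{k..<k}. c i / tail (Suc i))) < r"
    using assms(1)[unfolded safe_def] by (rule bspec) (use assms in simp)
  then show ?thesis by simp
qed

lemma safe_pos:
  assumes "safe k r" "1 \<le> k" "k \<le> n"
  shows "0 < r"
proof -
  have "0 \<le> tail k * c k / w k"
    using assms tail_pos[of k] c_nonneg[of k] w_pos[of k] by simp
  then show ?thesis using safe_covers_fee[OF assms] by linarith
qed

text \<open>
  The threshold is chosen to reproduce itself: a player who spends at most the fraction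
  $w_k/W_k$ of his resources and then pays the fee is still above the threshold of the next stage.
\<close>

lemma safe_step:
  assumes r: "safe k r" and k: "1 \<le> k" "k < n"
  shows "safe (Suc k) (tail (Suc k) * r / tail k - c k)"
  unfolding safe_def
proof
  fix l assume l: "l \<in> {Suc k..n}"
  let ?S = "c l / w l + (\<Sum>i\<in>{Suc k..<l}. c i / tail (Suc i))"
  have pos: "0 < tail k" "0 < tail (Suc k)"
    using k by (auto intro: tail_pos)
  have "tail k * (c l / w l + (\<Sum>i\<in>{k..<l}. c i / tail (Suc i))) < r"
    using r[unfolded safe_def] by (rule bspec) (use l in simp)
  moreover have "(\<Sum>i\<in>{k..<l}. c i / tail (Suc i)) =
      c k / tail (Suc k) + (\<Sum>i\<in>{Suc k..<l}. c i / tail (Suc i))"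
    using l by (intro sum.atLeast_Suc_lessThan) auto
  ultimately have "tail k * (?S + c k / tail (Suc k)) < r"
    by (simp add: add_ac)
  then have "tail (Suc k) * (tail k * (?S + c k / tail (Suc k))) / tail k < tail (Suc k) * r / tail k"
    using pos by (intro divide_strict_right_mono mult_strict_left_mono)
  also have "tail (Suc k) * (tail k * (?S + c k / tail (Suc k))) / tail k = tail (Suc k) * ?S + c k"
    using pos by (simp add: field_simps)
  finally show "tail (Suc k) * ?S < tail (Suc k) * r / tail k - c k"
    by simp
qed

text \<open>
  The bid of the strategy under consideration, as a function of the resources alone and without the
  fallback to 0. For a safe player the fallback is never needed, whatever the others own
  (\<open>sigma_investment_eq\<close>).
\<close>

definition proportional_bid :: "nat \<Rightarrow> ('p \<Rightarrow> real) \<Rightarrow> 'p \<Rightarrow> real" where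
  "proportional_bid k R i = w k * R i / tail k - R i * c k / (\<Sum>j\<in>UNIV. R j)"

text \<open>
  The current fee enters the threshold through $W_k c_k / w_k$, which makes the bid positive. The bid
  is affordable because what is left is above the next threshold; in the last stage there is
  no fee and the bid is the whole resource.
\<close>

lemma proportional_bid_safe:
  assumes R: "\<forall>j. 0 \<le> R j" and r: "safe k (R i)" and k: "1 \<le> k" "k \<le> n"
  shows "0 < proportional_bid k R i"
    and "proportional_bid k R i + c k \<le> R i"
    and "k < n \<Longrightarrow> safe (Suc k) (R i - proportional_bid k R i - c k)"
proof -
  let ?T = "\<Sum>j\<in>UNIV. R j"
  have pos: "0 < R i" "0 < tail k" "0 < w k" "0 \<le> c k"
    using safe_pos[OF r k] tail_pos[OF k] w_pos[OF k] c_nonneg[OF k] by auto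
  have T: "R i \<le> ?T" by (rule le_sum_of_nonneg[OF R])
  have "tail k * c k / w k < ?T"
    using safe_covers_fee[OF r k] T by linarith
  then have "c k * tail k < w k * ?T"
    using pos by (simp add: pos_divide_less_eq mult.commute)
  moreover have "0 < ?T" using pos T by linarith
  ultimately have "c k / ?T < w k / tail k"
    using pos by (simp add: pos_divide_less_eq pos_less_divide_eq mult.commute)
  then have "R i * (c k / ?T) < R i * (w k / tail k)"
    using pos by (intro mult_strict_left_mono)
  then show "0 < proportional_bid k R i"
    by (simp add: proportional_bid_def mult.commute)
  \<comment> \<open>The fee correction only lowers the bid, so the player keeps at least what \<open>safe_step\<close> asks for.\<close>
  have rest: "tail (Suc k) * R i / tail k - c k \<le> R i - proportional_bid k R i - c k"
  proof -
    have "tail (Suc k) * R i / tail k = R i - w k * R i / tail k"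
      using pos tail_Suc[OF k(2)] by (simp add: diff_divide_eq_iff algebra_simps)
    moreover have "0 \<le> R i * c k / ?T"
      using pos T by (intro divide_nonneg_nonneg mult_nonneg_nonneg) linarith+
    ultimately show ?thesis by (simp add: proportional_bid_def)
  qed
  show *: "safe (Suc k) (R i - proportional_bid k R i - c k)" if "k < n"
    by (rule safe_mono[OF safe_step[OF r k(1) that] rest])
  show "proportional_bid k R i + c k \<le> R i"
  proof (cases "k = n")
    case True
    then show ?thesis using rest c_last tail_past_end by simp
  next
    case False
    then have "k < n" using k by simp
    then show ?thesis using safe_pos[OF *] k by simp
  qed
qed

lemma sigma_investment_eq:
  assumes R: "\<forall>j. 0 \<le> resources c A h k j" and r: "safe k (resources c A h k i)"
    and k: "1 \<le> k" "k \<le> n"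
  shows "sigma_investment n w c A i k h = proportional_bid k (resources c A h k) i"
proof -
  have "legal_investment (c k) (resources c A h k i) (proportional_bid k (resources c A h k) i)"
    using proportional_bid_safe[OF R r k] c_nonneg[OF k] by (auto simp: legal_investment_def)
  then show ?thesis
    by (simp add: sigma_investment_def proportional_bid_def Let_def)
qed

definition next_resources :: "nat \<Rightarrow> ('p \<Rightarrow> real) \<Rightarrow> ('p \<Rightarrow> real) \<Rightarrow> 'p option \<Rightarrow> 'p \<Rightarrow> real" where
  "next_resources k R x r j = R j - x j - (if r = Some j then c k else 0)"

text \<open>
  A player who cannot afford the fee must invest 0 and therefore wins with probability 0. This is why
  the claim is restricted to winners that can occur.
\<close>

lemma next_resources_nonneg:
  assumes R: "\<forall>j. 0 \<le> R j" and x: "\<forall>j. legal_investment (c k) (R j) (x j)"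
    and k: "1 \<le> k" "k \<le> n" and r: "r \<in> set_pmf (winner_pmf x)"
  shows "0 \<le> next_resources k R x r j"
proof -
  note b = legal_investment_bounds[OF x[rule_format] c_nonneg[OF k] R[rule_format]]
  have "x j \<noteq> 0" if "r = Some j"
    using r that by (auto simp: set_pmf_eq winner_pmf_eq split: if_splits)
  then show ?thesis
    using b[of j] by (auto simp: next_resources_def)
qed

lemma next_resources_safe:
  assumes R: "\<forall>j. 0 \<le> R j" and r: "safe k (R i)" and k: "1 \<le> k" "k < n"
    and x: "x i = proportional_bid k R i"
  shows "safe (Suc k) (next_resources k R x r i)"
  by (rule safe_mono[OF proportional_bid_safe(3)[OF R r k(1) less_imp_le[OF k(2)] k(2)]])
     (use k c_nonneg[of k] x in \<open>auto simp: next_resources_def\<close>)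

lemma sum_next_resources:
  "(\<Sum>j\<in>UNIV. next_resources k R x (Some l) j) =
     (\<Sum>j\<in>UNIV. R j) - c k - (\<Sum>j\<in>UNIV. x j)"
  by (simp add: next_resources_def sum_subtractf)

text \<open>
  The value of the play from stage \<open>k\<close> on for player \<open>i\<close>: the remaining payoff is split in
  proportion to the resources.
\<close>

definition share :: "nat \<Rightarrow> ('p \<Rightarrow> real) \<Rightarrow> 'p \<Rightarrow> real" where
  "share k R i = tail k * R i / (\<Sum>j\<in>UNIV. R j)"

text \<open>
  The expected gain of a proportional bidder over his share when the investments at stage \<open>k\<close> are \<open>x\<close>;
  it is the square term in \<open>stage_value_identity\<close>.
\<close>

definition stage_gap :: "nat \<Rightarrow> ('p \<Rightarrow> real) \<Rightarrow> ('p \<Rightarrow> real) \<Rightarrow> 'p \<Rightarrow> real" where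
  "stage_gap k R x i =
     (let T = \<Sum>j\<in>UNIV. R j; z = \<Sum>j\<in>UNIV. x j
      in R i * (w k * T / tail k - c k - z)\<^sup>2 * tail k / (T * z * (T - c k - z)))"

context
  fixes k :: nat and R x :: "'p \<Rightarrow> real" and i :: 'p
  assumes k: "1 \<le> k" "k \<le> n" and R: "\<forall>j. 0 \<le> R j" and r: "safe k (R i)"
    and x: "\<forall>j. legal_investment (c k) (R j) (x j)" and xi: "x i = proportional_bid k R i"
begin

text \<open>
  If the proportional bidder wins, he and everybody else are left with nonnegative resources, and
  before the last stage he himself is left with something. Since the total that is left does not
  depend on who wins, it is nonnegative, and it can be 0 only at the last stage.
\<close>

lemma stage_facts:
  shows "0 \<le> x j" "0 < R i" "0 < x i" "0 < (\<Sum>j\<in>UNIV. x j)" "0 < (\<Sum>j\<in>UNIV. R j)"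
    "0 \<le> (\<Sum>j\<in>UNIV. R j) - c k - (\<Sum>j\<in>UNIV. x j)"
    "(\<Sum>j\<in>UNIV. R j) - c k - (\<Sum>j\<in>UNIV. x j) = 0 \<Longrightarrow> k = n"
proof -
  have xn: "0 \<le> x j" for j
    using legal_investment_bounds(1)[OF x[rule_format] c_nonneg[OF k] R[rule_format]] .
  then show "0 \<le> x j" .
  show Rp: "0 < R i" by (rule safe_pos[OF r k])
  show xp: "0 < x i" using proportional_bid_safe(1)[OF R r k] xi by simp
  show zp: "0 < (\<Sum>j\<in>UNIV. x j)"
    using xp le_sum_of_nonneg[of x i] xn by auto
  show "0 < (\<Sum>j\<in>UNIV. R j)"
    using Rp le_sum_of_nonneg[OF R, of i] by simp
  have "\<exists>j. x j \<noteq> 0" using xp by (intro exI[of _ i]) simp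
  then have "Some i \<in> set_pmf (winner_pmf x)"
    using xn xp zp by (auto simp: set_pmf_eq winner_pmf_eq)
  then have nn: "\<forall>j. 0 \<le> next_resources k R x (Some i) j"
    using next_resources_nonneg[OF R x k] by blast
  then show "0 \<le> (\<Sum>j\<in>UNIV. R j) - c k - (\<Sum>j\<in>UNIV. x j)"
    unfolding sum_next_resources[symmetric, of _ _ _ i] by (simp add: sum_nonneg)
  show "k = n" if "(\<Sum>j\<in>UNIV. R j) - c k - (\<Sum>j\<in>UNIV. x j) = 0"
  proof (rule ccontr)
    assume "k \<noteq> n"
    then have "k < n" using k by simp
    then have "0 < next_resources k R x (Some i) i"
      using next_resources_safe[where i = i and x = x and r = "Some i" and R = R, OF R r k(1) _ xi]
        safe_pos[of "Suc k"] by simp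
    then show False
      using that le_sum_of_nonneg[OF nn, of i] sum_next_resources[of k R x i] by simp
  qed
qed

text \<open>
  The constant \<open>v\<close> stands for the payoff already collected. It is carried along because the
  probabilities of the winners add up to 1: the positive bid of player \<open>i\<close> excludes a stage
  without winner.
\<close>

lemma stage_value:
  "(\<Sum>r\<in>UNIV. pmf (winner_pmf x) r *
      (v + (if r = Some i then w k else 0) + share (Suc k) (next_resources k R x r) i))
    = v + share k R i + stage_gap k R x i"
proof -
  let ?T = "\<Sum>j\<in>UNIV. R j" and ?z = "\<Sum>j\<in>UNIV. x j" and ?W' = "tail (Suc k)"
  note f = stage_facts
  have "\<exists>j. x j \<noteq> 0" using f(3) by (intro exI[of _ i]) simp
  then have p: "pmf (winner_pmf x) (Some j) = x j / ?z" "pmf (winner_pmf x) None = 0" for j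
    using f(1) by (simp_all add: winner_pmf_eq)
  have W': "?W' = tail k - w k" using tail_Suc[OF k(2)] by simp
  have sh: "share (Suc k) (next_resources k R x (Some j)) i =
      ?W' * (R i - x i - (if j = i then c k else 0)) / (?T - c k - ?z)" for j
    unfolding share_def sum_next_resources by (simp add: next_resources_def)
  have "(\<Sum>r\<in>UNIV. pmf (winner_pmf x) r *
      (v + (if r = Some i then w k else 0) + share (Suc k) (next_resources k R x r) i)) =
    (\<Sum>j\<in>UNIV. x j / ?z *
      (v + (if j = i then w k else 0) + ?W' * (R i - x i - (if j = i then c k else 0)) / (?T - c k - ?z)))"
    by (simp add: UNIV_option_conv sum.reindex p sh)
  also have "\<dots> = x i / ?z * (v + w k + ?W' * (R i - x i - c k) / (?T - c k - ?z)) +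
     (\<Sum>j\<in>UNIV - {i}. x j / ?z * (v + ?W' * (R i - x i) / (?T - c k - ?z)))"
    by (subst sum.remove[of _ i]) (auto intro!: sum.cong)
  also have "(\<Sum>j\<in>UNIV - {i}. x j / ?z * (v + ?W' * (R i - x i) / (?T - c k - ?z))) =
     (?z - x i) / ?z * (v + ?W' * (R i - x i) / (?T - c k - ?z))"
    by (simp add: sum_distrib_right[symmetric] sum_divide_distrib[symmetric] sum.remove[of UNIV i x])
  also have "x i / ?z * (v + w k + ?W' * (R i - x i - c k) / (?T - c k - ?z)) +
     (?z - x i) / ?z * (v + ?W' * (R i - x i) / (?T - c k - ?z)) =
     v + (x i / ?z * (w k + (tail k - w k) * (R i - x i - c k) / (?T - c k - ?z)) +
      (?z - x i) / ?z * ((tail k - w k) * (R i - x i) / (?T - c k - ?z)))"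
    unfolding W' using f(4) by (simp add: distrib_left diff_divide_distrib left_diff_distrib)
  also have "\<dots> = v + share k R i + stage_gap k R x i"
  proof -
    have last: "tail k = w k \<and> c k = 0" if "?T - c k - ?z = 0"
      using f(7)[OF that] tail_Suc[of n] tail_past_end c_last by simp
    have "x i / ?z * (w k + (tail k - w k) * (R i - x i - c k) / (?T - c k - ?z)) +
      (?z - x i) / ?z * ((tail k - w k) * (R i - x i) / (?T - c k - ?z)) =
      tail k * R i / ?T + R i * (w k * ?T / tail k - c k - ?z)\<^sup>2 * tail k / (?T * ?z * (?T - c k - ?z))"
      by (rule stage_value_identity[OF f(5) tail_pos[OF k] f(4) last])
         (auto simp: xi proportional_bid_def)
    then show ?thesis by (simp add: share_def stage_gap_def Let_def)
  qed
  finally show ?thesis .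
qed

lemma stage_gap_nonneg: "0 \<le> stage_gap k R x i"
  using stage_facts(2,4,5,6) tail_pos[OF k] by (simp add: stage_gap_def Let_def)

text \<open>
  The gain vanishes only if the square does. If instead the denominator vanishes, all resources are
  spent in the last stage, which is the optimal total investment as well.
\<close>

lemma stage_gap_le_0:
  assumes "stage_gap k R x i \<le> 0"
  shows "(\<Sum>j\<in>UNIV. x j) = w k * (\<Sum>j\<in>UNIV. R j) / tail k - c k"
proof (cases "(\<Sum>j\<in>UNIV. R j) - c k - (\<Sum>j\<in>UNIV. x j) = 0")
  case True
  have "tail n = w n" using tail_Suc[of n] tail_past_end by simp
  then show ?thesis
    using True stage_facts(7)[OF True] c_last w_pos[of n] n_pos by simp
next
  case False
  have "stage_gap k R x i = 0" using assms stage_gap_nonneg by simp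
  then show ?thesis
    using False stage_facts(2,4,5) tail_pos[OF k]
    by (simp add: stage_gap_def Let_def)
qed

end

end

section \<open>Measurability of the game and legality of the strategies\<close>

lemma measurable_history_component:
  assumes "l \<in> {1..k}"
  shows "(\<lambda>h. h l) \<in> hist_space k \<rightarrow>\<^sub>M outcome_space"
  unfolding hist_space_def by (rule measurable_component_singleton[OF assms])

lemma measurable_history_investment:
  fixes j :: "'p::finite"
  assumes "l \<in> {1..k}"
  shows "(\<lambda>h. fst (h l) j) \<in> borel_measurable (hist_space k)"
proof -
  have "(\<lambda>z :: 'p outcome. fst z j) \<in> borel_measurable outcome_space"
    unfolding outcome_space_def
    by (rule measurable_compose[OF measurable_fst measurable_component_singleton]) simp
  then show ?thesis
    by (rule measurable_compose[OF measurable_history_component[OF assms]])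
qed

lemma measurable_history_winner:
  fixes j :: "'p::finite"
  assumes "l \<in> {1..k}"
  shows "Measurable.pred (hist_space k) (\<lambda>h. snd (h l) = Some j)"
proof -
  have "Measurable.pred outcome_space (\<lambda>z :: 'p outcome. snd z = Some j)"
    unfolding outcome_space_def by measurable
  then show ?thesis
    by (rule measurable_compose[OF measurable_history_component[OF assms]])
qed

lemma measurable_resources:
  "(\<lambda>h. resources c A h (Suc k) j) \<in> borel_measurable (hist_space k)"
  unfolding resources_def
  by (intro borel_measurable_diff borel_measurable_sum borel_measurable_add
      measurable_history_investment measurable_If predE[OF measurable_history_winner] borel_measurable_const)
     auto

lemma measurable_total_payoff:
  "(\<lambda>h. total_payoff k w h j) \<in> borel_measurable (hist_space k)"
  unfolding total_payoff_def
  by (intro borel_measurable_sum measurable_If predE[OF measurable_history_winner] borel_measurable_const)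

lemma measurable_sum_resources:
  "(\<lambda>h. \<Sum>j\<in>UNIV. resources c A h (Suc k) j) \<in> borel_measurable (hist_space k)"
  by (intro borel_measurable_sum measurable_resources)

lemma measurable_if_legal:
  assumes [measurable]: "r \<in> borel_measurable M" "a \<in> borel_measurable M"
  shows "(\<lambda>h. if legal_investment f (r h) (a h) then a h else 0) \<in> borel_measurable M"
  unfolding legal_investment_def by measurable

lemma measurable_sigma_investment:
  "(\<lambda>h. sigma_investment n w c A i (Suc k) h) \<in> borel_measurable (hist_space k)"
  unfolding sigma_investment_def Let_def
  by (intro measurable_if_legal borel_measurable_diff borel_measurable_divide
      borel_measurable_times borel_measurable_const measurable_resources measurable_sum_resources)

lemma legal_sigma_investment:
  "legal_investment (c k) (resources c A h k i) (sigma_investment n w c A i k h)"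
  by (auto simp: sigma_investment_def Let_def legal_investment_def)

lemma admissible_sigma: "admissible n c A i (sigma_strategy n w c A i)"
  unfolding admissible_def
proof (intro allI impI conjI ballI)
  fix k
  show "sigma_strategy n w c A i (Suc k) \<in> hist_space k \<rightarrow>\<^sub>M prob_algebra borel"
    unfolding sigma_strategy_def[abs_def]
    by (rule measurable_compose[OF measurable_sigma_investment measurable_return_prob_space])
next
  fix k h
  show "AE x in sigma_strategy n w c A i (Suc k) h.
      legal_investment (c (Suc k)) (resources c A h (Suc k) i) x"
  proof -
    have "Measurable.pred borel (legal_investment (c (Suc k)) (resources c A h (Suc k) i))"
      unfolding legal_investment_def[abs_def] by measurable
    then show ?thesis
      unfolding sigma_strategy_def
      using legal_sigma_investment[of c "Suc k" A h i n w] by (subst AE_return) simp_all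
  qed
qed

lemma admissible_measurable:
  assumes "\<forall>j. admissible n c A j (s j)"
  shows "measurable_profile n s"
  using assms by (auto simp: measurable_profile_def admissible_def)

lemma prob_space_investment:
  assumes "measurable_profile n s" "k < n" "h \<in> space (hist_space k)"
  shows "prob_space (s j (Suc k) h)" "sets (s j (Suc k) h) = sets borel"
proof -
  have "s j (Suc k) h \<in> space (prob_algebra borel)"
    using assms(1,2) unfolding measurable_profile_def
    by (intro measurable_space[OF _ assms(3)]) blast
  then show "prob_space (s j (Suc k) h)" "sets (s j (Suc k) h) = sets borel"
    by (auto simp: space_prob_algebra)
qed

lemma AE_joint_law_component:
  assumes "measurable_profile n s" "k < n" "h \<in> space (hist_space k)"
    and "AE y in s j (Suc k) h. P y"
  shows "AE x in joint_law s (Suc k) h. P (x j)"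
  unfolding joint_law_def
  using prob_space_investment(1)[OF assms(1-3)] UNIV_I assms(4)
  by (rule AE_PiM_component[where P = P and i = j and M = "\<lambda>j. s j (Suc k) h"])

lemma AE_joint_law_legal:
  fixes s :: "'p::finite \<Rightarrow> 'p strategy"
  assumes "\<forall>j. admissible n c A j (s j)" "k < n" "h \<in> space (hist_space k)"
  shows "AE x in joint_law s (Suc k) h.
      \<forall>j. legal_investment (c (Suc k)) (resources c A h (Suc k) j) (x j)"
proof (rule AE_all_countable[THEN iffD2], intro allI)
  fix j
  have "AE y in s j (Suc k) h. legal_investment (c (Suc k)) (resources c A h (Suc k) j) y"
    using assms by (simp add: admissible_def)
  then show "AE x in joint_law s (Suc k) h.
      legal_investment (c (Suc k)) (resources c A h (Suc k) j) (x j)"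
    by (rule AE_joint_law_component[OF admissible_measurable[OF assms(1)] assms(2,3)])
qed

lemma AE_joint_law_sigma:
  assumes "measurable_profile n s" "k < n" "h \<in> space (hist_space k)"
    and "s i = sigma_strategy n w c A i"
  shows "AE x in joint_law s (Suc k) h. x i = sigma_investment n w c A i (Suc k) h"
proof (rule AE_joint_law_component[OF assms(1-3)])
  show "AE y in s i (Suc k) h. y = sigma_investment n w c A i (Suc k) h"
    unfolding assms(4) sigma_strategy_def by (subst AE_return) auto
qed

lemma total_payoff_update:
  "total_payoff (Suc k) w (h(Suc k := (x, r))) i =
     total_payoff k w h i + (if r = Some i then w (Suc k) else 0)"
  by (auto simp: total_payoff_def intro!: sum.cong)

lemma (in fee_game) resources_update:
  "resources c A (h(Suc k := (x, r))) (Suc (Suc k)) =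
     next_resources (Suc k) (resources c A h (Suc k)) x r"
  by (auto simp: fun_eq_iff resources_def next_resources_def)

section \<open>The potential of a proportional player is a submartingale\<close>

context fee_game
begin

text \<open>
  What player \<open>i\<close> has collected in \<open>k\<close> stages plus the value of what he still owns. It starts as
  the payoff claimed in the theorem and ends as the actual payoff.
\<close>

definition potential :: "nat \<Rightarrow> 'p \<Rightarrow> 'p history \<Rightarrow> real" where
  "potential k i h = total_payoff k w h i + share (Suc k) (resources c A h (Suc k)) i"

lemma measurable_potential: "potential k i \<in> borel_measurable (hist_space k)"
proof -
  show ?thesis unfolding potential_def[abs_def] share_def
    by (intro borel_measurable_add borel_measurable_divide borel_measurable_times
        borel_measurable_const measurable_resources measurable_sum_resources measurable_total_payoff)
qed

text \<open>
  The invariant of a play in which player \<open>i\<close> follows the strategy: he stays above the threshold.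
  About the other players only nonnegativity is known, as they may play anything legal.
\<close>

definition on_course :: "nat \<Rightarrow> 'p \<Rightarrow> 'p history \<Rightarrow> bool" where
  "on_course k i h \<longleftrightarrow> (\<forall>j. 0 \<le> resources c A h (Suc k) j) \<and>
     (k < n \<longrightarrow> safe (Suc k) (resources c A h (Suc k) i))"

lemma measurable_on_course: "Measurable.pred (hist_space k) (on_course k i)"
proof -
  note [measurable] = measurable_resources
  show ?thesis unfolding on_course_def[abs_def] safe_def by measurable
qed

lemma initial_resources_pos: "0 < A j"
  using safe_pos[OF safe_initial] n_pos by simp

lemma share_nonneg: "\<forall>j. 0 \<le> R j \<Longrightarrow> 1 \<le> k \<Longrightarrow> 0 \<le> share k R i"
  by (simp add: share_def tail_nonneg sum_nonneg)

lemma total_payoff_nonneg: "k \<le> n \<Longrightarrow> 0 \<le> total_payoff k w h i"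
  unfolding total_payoff_def by (rule sum_nonneg) (simp add: less_imp_le w_pos)

lemma potential_nonneg: "k \<le> n \<Longrightarrow> on_course k i h \<Longrightarrow> 0 \<le> potential k i h"
  by (simp add: potential_def on_course_def total_payoff_nonneg share_nonneg)

text \<open>
  The inequality can be strict, since a stage in which nobody invests has no winner.
\<close>

lemma total_payoff_sum_le:
  fixes h :: "'p history"
  shows "(\<Sum>i\<in>UNIV. total_payoff n w h i) \<le> tail 1"
proof -
  have "(\<Sum>i\<in>UNIV. total_payoff n w h i) =
      (\<Sum>k\<in>{1..n}. \<Sum>i\<in>UNIV. if snd (h k) = Some i then w k else 0)"
    unfolding total_payoff_def by (rule sum.swap)
  also have "\<dots> \<le> (\<Sum>k\<in>{1..n}. w k)"
  proof (rule sum_mono)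
    fix k assume "k \<in> {1..n}"
    then show "(\<Sum>i\<in>UNIV. if snd (h k) = Some i then w k else 0) \<le> w k"
      using w_pos[of k] by (cases "snd (h k)") auto
  qed
  finally show ?thesis by (simp add: tail_payoff_def)
qed

lemma integrable_total_payoff:
  fixes i :: 'p
  assumes "measurable_profile n s"
  shows "integrable (play_law s n) (\<lambda>h. total_payoff n w h i)"
proof -
  interpret prob_space "play_law s n" by (rule prob_space_play_law[OF assms]) simp
  show ?thesis
  proof (rule integrable_const_bound[where B = "tail 1"])
    have "total_payoff n w h i \<le> tail 1" for h :: "'p history"
      using le_sum_of_nonneg[of "total_payoff n w h" i] total_payoff_nonneg[of n h]
        total_payoff_sum_le[of h] by simp
    then show "AE h in play_law s n. norm (total_payoff n w h i) \<le> tail 1"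
      using total_payoff_nonneg[of n _ i] by simp
    show "(\<lambda>h. total_payoff n w h i) \<in> borel_measurable (play_law s n)"
      using measurable_total_payoff sets_play_law[OF assms order_refl]
      by (simp cong: measurable_cong_sets)
  qed
qed

lemma expected_payoff_sum_le:
  fixes s :: "'p \<Rightarrow> 'p strategy"
  assumes "measurable_profile n s"
  shows "(\<Sum>i\<in>UNIV. expected_payoff n w s i) \<le> tail 1"
proof -
  interpret prob_space "play_law s n" by (rule prob_space_play_law[OF assms]) simp
  have "(\<Sum>i\<in>UNIV. expected_payoff n w s i)
      = (\<integral>h. (\<Sum>i\<in>UNIV. total_payoff n w h i) \<partial>play_law s n)"
    unfolding expected_payoff_def
    by (rule Bochner_Integration.integral_sum[symmetric]) (rule integrable_total_payoff[OF assms])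
  also have "\<dots> \<le> (\<integral>h. tail 1 \<partial>play_law s n)"
    by (intro integral_mono Bochner_Integration.integrable_sum integrable_total_payoff assms
        total_payoff_sum_le) simp_all
  also have "\<dots> = tail 1" by (simp add: prob_space)
  finally show ?thesis .
qed

text \<open>
  In the following context the opponents of \<open>i\<close> use arbitrary admissible strategies. The potential
  of \<open>i\<close> is then a submartingale, which gives the guarantee; given the investments at a stage,
  its expected increment is the stage gap, so it is a martingale only if all gaps vanish almost surely, which gives uniqueness.
\<close>

context
  fixes s :: "'p \<Rightarrow> 'p strategy" and i :: 'p
  assumes adm: "\<forall>j. admissible n c A j (s j)" and si: "s i = sigma_strategy n w c A i"
begin

lemmas meas = admissible_measurable[OF adm]

lemma AE_joint_law_course:
  assumes "k < n" "h \<in> space (hist_space k)" "on_course k i h"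
  shows "AE x in joint_law s (Suc k) h.
     (\<forall>j. legal_investment (c (Suc k)) (resources c A h (Suc k) j) (x j)) \<and>
     x i = proportional_bid (Suc k) (resources c A h (Suc k)) i"
proof -
  have "sigma_investment n w c A i (Suc k) h = proportional_bid (Suc k) (resources c A h (Suc k)) i"
    using assms by (intro sigma_investment_eq) (auto simp: on_course_def)
  then show ?thesis
    using AE_joint_law_legal[OF adm assms(1,2)] AE_joint_law_sigma[OF meas assms(1,2) si]
    by simp
qed

lemma AE_on_course: "k \<le> n \<Longrightarrow> AE h in play_law s k. on_course k i h"
proof (induction k)
  case 0
  have "on_course 0 i (\<lambda>_. undefined)"
    using safe_initial initial_resources_pos
    by (auto simp: on_course_def resources_def less_imp_le)
  then show ?case
    using measurable_on_course[of 0 i]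
    by (auto simp: AE_return hist_space_def space_PiM)
next
  case (Suc k)
  then have k: "k < n" by simp
  have sp: "space (play_law s k) = space (hist_space k)"
    using space_play_law[OF meas, of k] k by simp
  show ?case
  proof (rule AE_play_law_Suc[OF meas k measurable_on_course])
    have "AE h in play_law s k. on_course k i h" using Suc by simp
    then show "AE h in play_law s k. AE x in joint_law s (Suc k) h.
        \<forall>r\<in>set_pmf (winner_pmf x). on_course (Suc k) i (h(Suc k := (x, r)))"
    proof (rule AE_mp[OF _ AE_I2[OF impI]])
      fix h assume h: "h \<in> space (play_law s k)" and oc: "on_course k i h"
      then have h': "h \<in> space (hist_space k)" by (simp add: sp)
      show "AE x in joint_law s (Suc k) h.
          \<forall>r\<in>set_pmf (winner_pmf x). on_course (Suc k) i (h(Suc k := (x, r)))"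
        using AE_joint_law_course[OF k h' oc]
      proof (rule AE_mp[OF _ AE_I2[OF impI]], intro ballI)
        fix x r
        let ?R = "resources c A h (Suc k)"
        assume x: "(\<forall>j. legal_investment (c (Suc k)) (?R j) (x j)) \<and>
            x i = proportional_bid (Suc k) ?R i"
          and r: "r \<in> set_pmf (winner_pmf x)"
        have R: "\<forall>j. 0 \<le> ?R j" and saf: "safe (Suc k) (?R i)"
          using oc k by (auto simp: on_course_def)
        show "on_course (Suc k) i (h(Suc k := (x, r)))"
          unfolding on_course_def resources_update
          using next_resources_nonneg[OF R, of "Suc k" x r] next_resources_safe[OF R saf, of x r]
            x r k by auto
      qed
    qed
  qed
qed

lemma nn_integral_potential_step:
  assumes k: "k < n" and h: "h \<in> space (hist_space k)" and oc: "on_course k i h"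
  shows "(\<integral>\<^sup>+h'. ennreal (potential (Suc k) i h') \<partial>step_kernel s k h) =
    (\<integral>\<^sup>+x. ennreal (potential k i h + stage_gap (Suc k) (resources c A h (Suc k)) x i)
       \<partial>joint_law s (Suc k) h)"
proof -
  let ?R = "resources c A h (Suc k)"
  have R: "\<forall>j. 0 \<le> ?R j" and saf: "safe (Suc k) (?R i)"
    using oc k by (auto simp: on_course_def)
  have k': "1 \<le> Suc k" "Suc k \<le> n" using k by auto
  have "(\<integral>\<^sup>+h'. ennreal (potential (Suc k) i h') \<partial>step_kernel s k h) =
    (\<integral>\<^sup>+x. (\<Sum>r\<in>UNIV. ennreal (pmf (winner_pmf x) r) *
        ennreal (potential (Suc k) i (h(Suc k := (x, r))))) \<partial>joint_law s (Suc k) h)"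
    by (rule nn_integral_step_kernel[OF meas k h])
       (use measurable_potential in simp)
  also have "\<dots> = (\<integral>\<^sup>+x. ennreal (potential k i h + stage_gap (Suc k) ?R x i)
       \<partial>joint_law s (Suc k) h)"
  proof (rule nn_integral_cong_AE)
    show "AE x in joint_law s (Suc k) h. (\<Sum>r\<in>UNIV. ennreal (pmf (winner_pmf x) r) *
        ennreal (potential (Suc k) i (h(Suc k := (x, r))))) =
       ennreal (potential k i h + stage_gap (Suc k) ?R x i)"
      using AE_joint_law_course[OF k h oc]
    proof (rule AE_mp[OF _ AE_I2[OF impI]])
      fix x
      assume "(\<forall>j. legal_investment (c (Suc k)) (?R j) (x j)) \<and>
            x i = proportional_bid (Suc k) ?R i"
      then have x: "\<forall>j. legal_investment (c (Suc k)) (?R j) (x j)"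
        and xi: "x i = proportional_bid (Suc k) ?R i" by auto
      let ?V = "\<lambda>r. potential (Suc k) i (h(Suc k := (x, r)))"
      have V: "?V r = total_payoff k w h i + (if r = Some i then w (Suc k) else 0) +
          share (Suc (Suc k)) (next_resources (Suc k) ?R x r) i" for r
        by (simp only: potential_def resources_update total_payoff_update)
      \<comment> \<open>The potential may be negative for winners that have probability 0.\<close>
      have nn: "0 \<le> pmf (winner_pmf x) r * ?V r" for r
      proof (cases "r \<in> set_pmf (winner_pmf x)")
        case True
        then have "0 \<le> share (Suc (Suc k)) (next_resources (Suc k) ?R x r) i"
          using next_resources_nonneg[OF R x k'] by (intro share_nonneg) auto
        then have "0 \<le> ?V r"
          unfolding V using total_payoff_nonneg[of k h i] w_pos[OF k'] k by simp
        then show ?thesis by simp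
      next
        case False
        then show ?thesis by (simp add: set_pmf_iff)
      qed
      have "(\<Sum>r\<in>UNIV. ennreal (pmf (winner_pmf x) r) * ennreal (?V r)) =
          (\<Sum>r\<in>UNIV. ennreal (pmf (winner_pmf x) r * ?V r))"
        by (simp add: ennreal_mult')
      also have "\<dots> = ennreal (\<Sum>r\<in>UNIV. pmf (winner_pmf x) r * ?V r)"
        using nn by (rule sum_ennreal)
      also have "(\<Sum>r\<in>UNIV. pmf (winner_pmf x) r * ?V r) =
          potential k i h + stage_gap (Suc k) ?R x i"
        unfolding V stage_value[OF k' R saf x xi] by (simp add: potential_def)
      finally show "(\<Sum>r\<in>UNIV. ennreal (pmf (winner_pmf x) r) * ennreal (?V r)) =
          ennreal (potential k i h + stage_gap (Suc k) ?R x i)" .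
    qed
  qed
  finally show ?thesis .
qed

lemma AE_stage_gap_nonneg:
  assumes k: "k < n" and h: "h \<in> space (hist_space k)" and oc: "on_course k i h"
  shows "AE x in joint_law s (Suc k) h. 0 \<le> stage_gap (Suc k) (resources c A h (Suc k)) x i"
  using AE_joint_law_course[OF assms]
proof (rule AE_mp[OF _ AE_I2[OF impI]])
  fix x
  assume "(\<forall>j. legal_investment (c (Suc k)) (resources c A h (Suc k) j) (x j)) \<and>
     x i = proportional_bid (Suc k) (resources c A h (Suc k)) i"
  then show "0 \<le> stage_gap (Suc k) (resources c A h (Suc k)) x i"
    using oc k by (intro stage_gap_nonneg) (auto simp: on_course_def)
qed

lemma potential_le_step:
  assumes k: "k < n" and h: "h \<in> space (hist_space k)" and oc: "on_course k i h"
  shows "ennreal (potential k i h) \<le> (\<integral>\<^sup>+h'. ennreal (potential (Suc k) i h') \<partial>step_kernel s k h)"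
proof -
  interpret prob_space "joint_law s (Suc k) h" by (rule prob_space_joint_law[OF meas k h])
  have "ennreal (potential k i h) = (\<integral>\<^sup>+x. ennreal (potential k i h) \<partial>joint_law s (Suc k) h)"
    by (simp add: emeasure_space_1)
  also have "\<dots> \<le> (\<integral>\<^sup>+x. ennreal (potential k i h + stage_gap (Suc k) (resources c A h (Suc k)) x i)
       \<partial>joint_law s (Suc k) h)"
    by (rule nn_integral_mono_AE)
       (use AE_stage_gap_nonneg[OF assms] in \<open>auto intro!: ennreal_leI\<close>)
  finally show ?thesis unfolding nn_integral_potential_step[OF assms] .
qed

text \<open>
  A function that dominates a constant and has at most the same integral equals it almost
  everywhere. Hence, if the expected potential does not grow, the stage gap vanishes almost surely.
\<close>

lemma potential_tight_step:
  assumes k: "k < n" and h: "h \<in> space (hist_space k)" and oc: "on_course k i h"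
    and le: "(\<integral>\<^sup>+h'. ennreal (potential (Suc k) i h') \<partial>step_kernel s k h) \<le> ennreal (potential k i h)"
  shows "AE x in joint_law s (Suc k) h.
    (\<Sum>j\<in>UNIV. x j) = w (Suc k) * (\<Sum>j\<in>UNIV. resources c A h (Suc k) j) / tail (Suc k) - c (Suc k)"
proof -
  let ?R = "resources c A h (Suc k)" and ?J = "joint_law s (Suc k) h"
  interpret prob_space ?J by (rule prob_space_joint_law[OF meas k h])
  have m: "(\<lambda>x. \<Sum>j\<in>UNIV. x j) \<in> borel_measurable ?J"
    unfolding measurable_cong_sets[OF sets_joint_law[OF meas k h] refl]
    by (intro borel_measurable_sum measurable_component_singleton) simp
  then have mg: "(\<lambda>x. ennreal (potential k i h + stage_gap (Suc k) ?R x i)) \<in> borel_measurable ?J"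
    unfolding stage_gap_def Let_def by measurable
  have c: "(\<integral>\<^sup>+x. ennreal (potential k i h) \<partial>?J) = ennreal (potential k i h)"
    by (simp add: emeasure_space_1)
  have "AE x in ?J. ennreal (potential k i h + stage_gap (Suc k) ?R x i) \<le> ennreal (potential k i h)"
  proof (rule ccontr)
    assume neg: "\<not> ?thesis"
    have "(\<integral>\<^sup>+x. ennreal (potential k i h) \<partial>?J) <
        (\<integral>\<^sup>+x. ennreal (potential k i h + stage_gap (Suc k) ?R x i) \<partial>?J)"
      using mg neg AE_stage_gap_nonneg[OF k h oc]
      by (intro nn_integral_less) (auto simp: emeasure_space_1 intro!: ennreal_leI)
    then show False
      using le unfolding c nn_integral_potential_step[OF k h oc] by simp
  qed
  moreover have "0 \<le> potential k i h"
    using k oc by (intro potential_nonneg) auto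
  ultimately have "AE x in ?J. stage_gap (Suc k) ?R x i \<le> 0"
    by (auto simp: ennreal_le_iff)
  then show ?thesis
    using AE_joint_law_course[OF k h oc]
  proof eventually_elim
    case (elim x)
    then show ?case
      using oc k by (intro stage_gap_le_0[where i = i]) (auto simp: on_course_def)
  qed
qed

lemma nn_integral_potential_mono_Suc:
  assumes k: "k < n"
  shows "(\<integral>\<^sup>+h. ennreal (potential k i h) \<partial>play_law s k)
     \<le> (\<integral>\<^sup>+h. ennreal (potential (Suc k) i h) \<partial>play_law s (Suc k))"
proof -
  have "(\<integral>\<^sup>+h. ennreal (potential k i h) \<partial>play_law s k)
     \<le> (\<integral>\<^sup>+h. \<integral>\<^sup>+h'. ennreal (potential (Suc k) i h') \<partial>step_kernel s k h \<partial>play_law s k)"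
  proof (rule nn_integral_mono_AE)
    show "AE h in play_law s k. ennreal (potential k i h) \<le>
        (\<integral>\<^sup>+h'. ennreal (potential (Suc k) i h') \<partial>step_kernel s k h)"
      using AE_on_course[of k] k space_play_law[OF meas, of k]
      by (auto intro!: AE_mp[OF AE_on_course AE_I2] potential_le_step)
  qed
  also have "\<dots> = (\<integral>\<^sup>+h. ennreal (potential (Suc k) i h) \<partial>play_law s (Suc k))"
    using measurable_potential by (intro nn_integral_play_law_Suc[symmetric, OF meas k]) simp
  finally show ?thesis .
qed

lemma nn_integral_potential_mono:
  assumes "k \<le> l" "l \<le> n"
  shows "(\<integral>\<^sup>+h. ennreal (potential k i h) \<partial>play_law s k)
     \<le> (\<integral>\<^sup>+h. ennreal (potential l i h) \<partial>play_law s l)"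
  using assms
proof (induction l rule: dec_induct)
  case (step l)
  then show ?case using nn_integral_potential_mono_Suc[of l] by (simp del: play_law.simps)
qed simp

lemma nn_integral_potential_0:
  "(\<integral>\<^sup>+h. ennreal (potential 0 i h) \<partial>play_law s 0) = ennreal (share 1 A i)"
proof -
  have "resources c A (\<lambda>_. undefined) (Suc 0) = A"
    by (simp add: fun_eq_iff resources_def)
  then have "potential 0 i (\<lambda>_. undefined) = share 1 A i"
    by (simp add: potential_def total_payoff_def)
  moreover have "(\<integral>\<^sup>+h. ennreal (potential 0 i h) \<partial>play_law s 0)
      = ennreal (potential 0 i (\<lambda>_. undefined))"
    unfolding play_law.simps using measurable_potential[of 0 i]
    by (intro nn_integral_return) (auto simp: hist_space_def space_PiM)
  ultimately show ?thesis by simp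
qed

lemma nn_integral_potential_n:
  "(\<integral>\<^sup>+h. ennreal (potential n i h) \<partial>play_law s n) = ennreal (expected_payoff n w s i)"
proof -
  have "potential n i = (\<lambda>h. total_payoff n w h i)"
    by (simp add: fun_eq_iff potential_def share_def tail_past_end)
  then show ?thesis
    unfolding expected_payoff_def
    using nn_integral_eq_integral[OF integrable_total_payoff[OF meas, of i]]
    by (simp add: total_payoff_nonneg)
qed

text \<open>
  The expected potential does not decrease on its way from the initial share to the expected payoff.
\<close>

lemma expected_payoff_ge_share: "share 1 A i \<le> expected_payoff n w s i"
proof -
  have "0 \<le> expected_payoff n w s i"
    unfolding expected_payoff_def by (simp add: integral_nonneg total_payoff_nonneg)
  then show ?thesis
    using nn_integral_potential_mono[of 0 n]
    unfolding nn_integral_potential_0 nn_integral_potential_n by (simp add: ennreal_le_iff)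
qed

text \<open>
  If the guarantee is attained, then the nondecreasing finite sequence of expected potentials is
  constant, so each of its steps is tight.
\<close>

lemma tight_total_investment:
  assumes "expected_payoff n w s i \<le> share 1 A i" and k: "k < n"
  shows "AE h in play_law s k. on_course k i h \<and> (AE x in joint_law s (Suc k) h.
    (\<Sum>j\<in>UNIV. x j) = w (Suc k) * (\<Sum>j\<in>UNIV. resources c A h (Suc k) j) / tail (Suc k) - c (Suc k))"
proof -
  let ?E = "\<lambda>k. \<integral>\<^sup>+h. ennreal (potential k i h) \<partial>play_law s k"
  let ?F = "\<lambda>h. \<integral>\<^sup>+h'. ennreal (potential (Suc k) i h') \<partial>step_kernel s k h"
  have "?E (Suc k) \<le> ?E n"
    using k by (intro nn_integral_potential_mono) auto
  also have "?E n \<le> ?E 0"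
    unfolding nn_integral_potential_0 nn_integral_potential_n using assms(1) by (rule ennreal_leI)
  also have "?E 0 \<le> ?E k"
    using k by (intro nn_integral_potential_mono) auto
  finally have le: "?E (Suc k) \<le> ?E k" .
  \<comment> \<open>Without finiteness, equal integrals would not force the integrands to agree.\<close>
  have "?E k \<le> ?E n" using k by (intro nn_integral_potential_mono) auto
  then have fin: "?E k \<noteq> \<infinity>"
    unfolding nn_integral_potential_n by (auto simp: top_unique)
  have sp: "space (play_law s k) = space (hist_space k)"
    and st: "sets (play_law s k) = sets (hist_space k)"
    using space_play_law[OF meas, of k] sets_play_law[OF meas, of k] k by auto
  have mp: "(\<lambda>h. ennreal (potential k i h)) \<in> borel_measurable (hist_space k)" for k
    using measurable_potential by simp
  have E: "?E (Suc k) = (\<integral>\<^sup>+h. ?F h \<partial>play_law s k)"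
    by (rule nn_integral_play_law_Suc[OF meas k mp])
  have mF: "?F \<in> borel_measurable (play_law s k)"
    by (rule measurable_compose[OF step_kernel_measurable_play_law[OF meas k]
          nn_integral_measurable_subprob_algebra[OF mp]])
  have oc: "AE h in play_law s k. on_course k i h"
    using k by (intro AE_on_course) simp
  have ge: "AE h in play_law s k. ennreal (potential k i h) \<le> ?F h"
    using oc by (rule AE_mp[OF _ AE_I2[OF impI]]) (auto simp: sp intro!: potential_le_step k)
  have "AE h in play_law s k. ?F h \<le> ennreal (potential k i h)"
  proof (rule ccontr)
    assume neg: "\<not> ?thesis"
    have "?E k < (\<integral>\<^sup>+h. ?F h \<partial>play_law s k)"
      by (rule nn_integral_less[OF _ mF fin ge neg])
         (use mp[of k] st in \<open>simp cong: measurable_cong_sets\<close>)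
    then show False using le E by simp
  qed
  then have "AE h in play_law s k. on_course k i h \<and> ?F h \<le> ennreal (potential k i h)"
    using oc by eventually_elim simp
  then show ?thesis
    by (rule AE_mp[OF _ AE_I2[OF impI]]) (auto simp: sp intro!: potential_tight_step k)
qed

end

end

section \<open>Equilibrium and uniqueness\<close>

lemma eq_return_if_AE_eq:
  fixes M :: "real measure"
  assumes "prob_space M" "sets M = sets borel" "AE x in M. x = a"
  shows "M = return borel a"
proof (rule measure_eqI)
  interpret prob_space M by fact
  show "sets M = sets (return borel a)" using assms(2) by simp
  fix B assume B: "B \<in> sets M"
  show "emeasure M B = emeasure (return borel a) B"
  proof (cases "a \<in> B")
    case True
    have "AE x in M. x \<in> B" using assms(3) by eventually_elim (simp add: True)
    then have "emeasure M B = 1" using B by (intro emeasure_eq_1_AE) auto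
    then show ?thesis using True B assms(2) by simp
  next
    case False
    have "AE x in M. x \<notin> B" using assms(3) by eventually_elim (simp add: False)
    then have "emeasure M {x \<in> space M. x \<in> B} = 0" by (rule emeasure_eq_0_AE)
    moreover have "{x \<in> space M. x \<in> B} = B" using sets.sets_into_space[OF B] by auto
    ultimately show ?thesis using False B assms(2) by simp
  qed
qed

text \<open>
  Two products that differ only in factor \<open>i\<close> have the same marginal on the other coordinates.
  This replaces the strategy of a deviating player by his equilibrium strategy in statements about
  the investments of his opponents.
\<close>

lemma AE_sum_others_transfer:
  fixes M M' :: "'p::finite \<Rightarrow> real measure"
  assumes M: "\<And>j. prob_space (M j)" "\<And>j. sets (M j) = sets borel"
    and M': "\<And>j. prob_space (M' j)" "\<And>j. sets (M' j) = sets borel"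
    and eq: "\<And>j. j \<noteq> i \<Longrightarrow> M' j = M j"
    and AE: "AE x in \<Pi>\<^sub>M j\<in>UNIV. M' j. (\<Sum>j\<in>UNIV - {i}. x j) = b"
  shows "AE x in \<Pi>\<^sub>M j\<in>UNIV. M j. (\<Sum>j\<in>UNIV - {i}. x j) = b"
proof -
  let ?J = "UNIV - {i}"
  have marginal: "(AE x in \<Pi>\<^sub>M j\<in>UNIV. N j. (\<Sum>j\<in>?J. x j) = b)
      \<longleftrightarrow> (AE y in \<Pi>\<^sub>M j\<in>?J. N j. (\<Sum>j\<in>?J. y j) = b)"
    if N: "\<And>j. prob_space (N j)" "\<And>j. sets (N j) = sets borel" for N :: "'p \<Rightarrow> real measure"
  proof -
    interpret product_prob_space N UNIV
      using N(1) by (rule product_prob_spaceI)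
    have m: "(\<lambda>y. \<Sum>j\<in>?J. y j) \<in> borel_measurable (\<Pi>\<^sub>M j\<in>?J. N j)"
    proof (intro borel_measurable_sum)
      fix j assume "j \<in> ?J"
      then have "(\<lambda>y. y j) \<in> (\<Pi>\<^sub>M j\<in>?J. N j) \<rightarrow>\<^sub>M N j" by (rule measurable_component_singleton)
      then show "(\<lambda>y. y j) \<in> borel_measurable (\<Pi>\<^sub>M j\<in>?J. N j)"
        by (simp add: measurable_cong_sets[OF refl N(2)])
    qed
    have r: "(\<lambda>x. restrict x ?J) \<in> (\<Pi>\<^sub>M j\<in>UNIV. N j) \<rightarrow>\<^sub>M (\<Pi>\<^sub>M j\<in>?J. N j)"
      by (rule measurable_restrict_subset) simp
    have d: "distr (\<Pi>\<^sub>M j\<in>UNIV. N j) (\<Pi>\<^sub>M j\<in>?J. N j) (\<lambda>x. restrict x ?J) = (\<Pi>\<^sub>M j\<in>?J. N j)"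
      by (rule distr_restrict[symmetric]) auto
    have p: "{y \<in> space (\<Pi>\<^sub>M j\<in>?J. N j). (\<Sum>j\<in>?J. y j) = b} \<in> sets (\<Pi>\<^sub>M j\<in>?J. N j)"
      using measurable_sets[OF m, of "{b}"] by (simp add: vimage_def Int_def conj_commute)
    have restrict: "(\<Sum>j\<in>?J. restrict x ?J j) = (\<Sum>j\<in>?J. x j)" for x :: "'p \<Rightarrow> real"
      by (rule sum.cong) simp_all
    have "(AE y in \<Pi>\<^sub>M j\<in>?J. N j. (\<Sum>j\<in>?J. y j) = b) \<longleftrightarrow>
        (AE x in \<Pi>\<^sub>M j\<in>UNIV. N j. (\<Sum>j\<in>?J. restrict x ?J j) = b)"
      using AE_distr_iff[OF r p] unfolding d .
    then show ?thesis unfolding restrict by (rule sym)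
  qed
  have same: "(\<Pi>\<^sub>M j\<in>?J. M' j) = (\<Pi>\<^sub>M j\<in>?J. M j)"
    by (rule PiM_cong) (simp_all add: eq)
  show ?thesis
    using AE unfolding marginal[of M', OF M'] marginal[of M, OF M] same .
qed

text \<open>
  The difference of the two vectors has in each coordinate the value of its total, so the total
  equals its multiple by the number of players. With at least two players it must be 0.
\<close>

lemma eq_if_sums_of_others_eq:
  fixes x a :: "'p::finite \<Rightarrow> real"
  assumes "CARD('p) \<ge> 2" and eq: "\<forall>i. (\<Sum>j\<in>UNIV - {i}. x j) = (\<Sum>j\<in>UNIV - {i}. a j)"
  shows "x = a"
proof -
  let ?d = "\<lambda>j. x j - a j"
  have d: "?d i = (\<Sum>j\<in>UNIV. ?d j)" for i
    using eq[rule_format, of i] by (simp add: sum.remove[of UNIV i] sum_subtractf)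
  define D where "D = (\<Sum>j\<in>UNIV. ?d j)"
  have "D = (\<Sum>i\<in>(UNIV :: 'p set). D)"
    unfolding D_def by (rule sum.cong[OF refl d])
  also have "\<dots> = real CARD('p) * D" by simp
  finally have "(real CARD('p) - 1) * D = 0" by (simp add: left_diff_distrib)
  then have "D = 0" using assms(1) by simp
  then have "(\<Sum>j\<in>UNIV. ?d j) = 0" by (simp only: D_def)
  then have "?d i = 0" for i by (simp only: d[of i])
  then show ?thesis by (simp add: fun_eq_iff)
qed

context fee_game
begin

abbreviation sigma :: "'p \<Rightarrow> 'p strategy" where
  "sigma \<equiv> sigma_strategy n w c A"

lemma sum_share: "(\<Sum>i\<in>UNIV. share 1 A i) = tail 1"
proof -
  have "0 < (\<Sum>j\<in>UNIV. A j)"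
    using initial_resources_pos by (intro sum_pos) auto
  then show ?thesis
    by (simp add: share_def flip: sum_distrib_left sum_divide_distrib)
qed

lemma guarantee:
  assumes "\<forall>j. j \<noteq> i \<longrightarrow> admissible n c A j (s j)"
  shows "share 1 A i \<le> expected_payoff n w (s(i := sigma i)) i"
  using assms by (intro expected_payoff_ge_share) (auto simp: admissible_sigma)

text \<open>
  The shares add up to all there is to win, so if everybody gets at least his share, nobody gets
  more.
\<close>

lemma payoffs_eq_shares:
  assumes "\<forall>i. admissible n c A i (s i)" and "\<forall>i. share 1 A i \<le> expected_payoff n w s i"
  shows "expected_payoff n w s i = share 1 A i"
proof (rule antisym)
  have "(\<Sum>j\<in>UNIV - {i}. share 1 A j) \<le> (\<Sum>j\<in>UNIV - {i}. expected_payoff n w s j)"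
    using assms(2) by (intro sum_mono) simp
  moreover have "(\<Sum>j\<in>UNIV. expected_payoff n w s j) \<le> (\<Sum>j\<in>UNIV. share 1 A j)"
    unfolding sum_share by (rule expected_payoff_sum_le[OF admissible_measurable[OF assms(1)]])
  ultimately show "expected_payoff n w s i \<le> share 1 A i"
    by (simp add: sum.remove[of UNIV i])
qed (use assms in simp)

lemma expected_payoff_sigma: "expected_payoff n w sigma i = share 1 A i"
proof (rule payoffs_eq_shares)
  show "\<forall>i. share 1 A i \<le> expected_payoff n w sigma i"
    using expected_payoff_ge_share[of sigma] by (simp add: admissible_sigma)
qed (simp add: admissible_sigma)

text \<open>
  The opponents of a deviating player are still guaranteed their shares, which leaves him at most
  his own.
\<close>

lemma nash_sigma: "nash_equilibrium n w c A sigma"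
  unfolding nash_equilibrium_def
proof (intro conjI allI impI)
  fix i show "admissible n c A i (sigma i)" by (rule admissible_sigma)
next
  fix i t assume t: "admissible n c A i t"
  let ?s = "sigma(i := t)"
  have adm: "\<forall>j. admissible n c A j (?s j)"
    using t by (simp add: admissible_sigma)
  have "(\<Sum>j\<in>UNIV - {i}. share 1 A j) \<le> (\<Sum>j\<in>UNIV - {i}. expected_payoff n w ?s j)"
    using adm by (intro sum_mono expected_payoff_ge_share) auto
  moreover have "(\<Sum>j\<in>UNIV. expected_payoff n w ?s j) \<le> (\<Sum>j\<in>UNIV. share 1 A j)"
    unfolding sum_share by (rule expected_payoff_sum_le[OF admissible_measurable[OF adm]])
  ultimately show "expected_payoff n w ?s i \<le> expected_payoff n w sigma i"
    by (simp add: sum.remove[of UNIV i] expected_payoff_sigma)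
qed

text \<open>
  In an equilibrium every player gets at least what the proportional strategy would guarantee him,
  hence exactly his share; so switching to the proportional strategy cannot bring him more than that.
\<close>

lemma nash_tight:
  assumes t: "nash_equilibrium n w c A t"
  shows "expected_payoff n w (t(i := sigma i)) i \<le> share 1 A i"
proof -
  have adm: "\<forall>j. admissible n c A j (t j)"
    using t by (simp add: nash_equilibrium_def)
  have dev: "expected_payoff n w (t(j := sigma j)) j \<le> expected_payoff n w t j" for j
    using t by (simp add: nash_equilibrium_def admissible_sigma)
  have "\<forall>j. share 1 A j \<le> expected_payoff n w t j"
    using guarantee[of _ t] adm dev order_trans by blast
  then show ?thesis
    using payoffs_eq_shares[OF adm] dev[of i] by simp
qed

text \<open>
  After a history in which all players are on course, tightness for player \<open>i\<close> fixes the total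
  investment when \<open>i\<close> bids proportionally, that is, the sum of the investments of his opponents.
  Having this for all \<open>i\<close> determines each single investment, so at such a history nobody
  randomises in an equilibrium.
\<close>

lemma investments_determined:
  fixes t :: "'p \<Rightarrow> 'p strategy"
  assumes card: "CARD('p) \<ge> 2" and adm: "\<forall>j. admissible n c A j (t j)"
    and k: "k < n" and h: "h \<in> space (hist_space k)" and oc: "\<forall>i. on_course k i h"
    and tight: "\<forall>i. AE x in joint_law (t(i := sigma i)) (Suc k) h. (\<Sum>j\<in>UNIV. x j) =
        w (Suc k) * (\<Sum>j\<in>UNIV. resources c A h (Suc k) j) / tail (Suc k) - c (Suc k)"
  shows "t i (Suc k) h = sigma i (Suc k) h"
proof -
  let ?R = "resources c A h (Suc k)"
  let ?a = "proportional_bid (Suc k) ?R"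
  let ?T = "\<Sum>j\<in>UNIV. ?R j"
  have R: "\<forall>j. 0 \<le> ?R j" and saf: "\<And>i. safe (Suc k) (?R i)"
    using oc k by (auto simp: on_course_def)
  have Tp: "0 < ?T"
    using safe_pos[OF saf] k by (intro sum_pos) auto
  have sum_a: "(\<Sum>j\<in>UNIV. ?a j) = w (Suc k) * ?T / tail (Suc k) - c (Suc k)"
    using Tp by (simp add: proportional_bid_def sum_subtractf flip: sum_divide_distrib
        sum_distrib_left sum_distrib_right)
  note mt = admissible_measurable[OF adm]
  have others: "AE x in joint_law t (Suc k) h. (\<Sum>j\<in>UNIV - {i}. x j) = (\<Sum>j\<in>UNIV - {i}. ?a j)" for i
  proof -
    let ?s = "t(i := sigma i)"
    have adms: "\<forall>j. admissible n c A j (?s j)"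
      using adm by (simp add: admissible_sigma)
    note ms = admissible_measurable[OF adms]
    have "AE x in joint_law ?s (Suc k) h. (\<Sum>j\<in>UNIV - {i}. x j) = (\<Sum>j\<in>UNIV - {i}. ?a j)"
      using tight[rule_format, of i] AE_joint_law_course[OF adms fun_upd_same k h oc[rule_format]]
    proof eventually_elim
      case (elim x)
      then show ?case
        using sum_a by (simp add: sum.remove[of UNIV i])
    qed
    then show ?thesis
      unfolding joint_law_def
      by (rule AE_sum_others_transfer[rotated -1])
         (use prob_space_investment[OF mt k h] prob_space_investment[OF ms k h] in auto)
  qed
  have "AE x in joint_law t (Suc k) h. \<forall>i. (\<Sum>j\<in>UNIV - {i}. x j) = (\<Sum>j\<in>UNIV - {i}. ?a j)"
    using others by (intro AE_all_countable[THEN iffD2] allI)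
  then have ae: "AE x in joint_law t (Suc k) h. x i = ?a i"
    by (rule AE_mp[OF _ AE_I2[OF impI]]) (rule fun_cong[OF eq_if_sums_of_others_eq[OF card]])
  have ti: "prob_space (t i (Suc k) h)" "sets (t i (Suc k) h) = sets borel"
    using prob_space_investment[OF mt k h] by auto
  have "AE y in t i (Suc k) h. y = ?a i"
  proof -
    have d: "distr (joint_law t (Suc k) h) (t i (Suc k) h) (\<lambda>x. x i) = t i (Suc k) h"
      unfolding joint_law_def
      by (rule distr_PiM_component) (use prob_space_investment[OF mt k h] in auto)
    have "AE y in distr (joint_law t (Suc k) h) (t i (Suc k) h) (\<lambda>x. x i). y = ?a i"
    proof (subst AE_distr_iff)
      show "(\<lambda>x. x i) \<in> joint_law t (Suc k) h \<rightarrow>\<^sub>M t i (Suc k) h"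
        unfolding joint_law_def by (rule measurable_component_singleton) simp
      show "{y \<in> space (t i (Suc k) h). y = ?a i} \<in> sets (t i (Suc k) h)"
        using sets_eq_imp_space_eq[OF ti(2)] by (simp add: ti(2))
    qed (rule ae)
    then show ?thesis unfolding d .
  qed
  then have "t i (Suc k) h = return borel (?a i)"
    by (rule eq_return_if_AE_eq[OF ti])
  also have "?a i = sigma_investment n w c A i (Suc k) h"
    using k by (intro sigma_investment_eq[symmetric] R saf) auto
  finally show ?thesis by (simp add: sigma_strategy_def)
qed

text \<open>
  The tightness obtained for player \<open>i\<close> concerns the play in which he has switched to the
  proportional strategy. By induction the equilibrium prescribed this strategy to him in all earlier
  stages anyway, so both plays reach the same histories with the same law.
\<close>

lemma nash_agrees_with_sigma:
  assumes card: "CARD('p) \<ge> 2" and t: "nash_equilibrium n w c A t"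
  shows "agree_in_play n t sigma"
proof -
  have adm: "\<forall>j. admissible n c A j (t j)"
    using t by (simp add: nash_equilibrium_def)
  note mt = admissible_measurable[OF adm]
  have "AE h in play_law t k. \<forall>i. t i (Suc k) h = sigma i (Suc k) h" if "k < n" for k
    using that
  proof (induction k rule: less_induct)
    case (less k)
    note k = less.prems
    let ?tight = "\<lambda>i h. AE x in joint_law (t(i := sigma i)) (Suc k) h. (\<Sum>j\<in>UNIV. x j) =
        w (Suc k) * (\<Sum>j\<in>UNIV. resources c A h (Suc k) j) / tail (Suc k) - c (Suc k)"
    have "AE h in play_law t k. on_course k i h \<and> ?tight i h" for i
    proof -
      let ?s = "t(i := sigma i)"
      have adms: "\<forall>j. admissible n c A j (?s j)"
        using adm by (simp add: admissible_sigma)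
      have eq: "play_law t k = play_law ?s k"
      proof (rule play_law_cong[OF mt admissible_measurable[OF adms] less_imp_le[OF k]],
          intro allI impI)
        fix l assume "l < k"
        then have "AE h in play_law t l. \<forall>j. t j (Suc l) h = sigma j (Suc l) h"
          using less.IH[of l] k by simp
        then show "AE h in play_law t l. \<forall>j. t j (Suc l) h = ?s j (Suc l) h"
          by (rule AE_mp[OF _ AE_I2[OF impI]]) simp
      qed
      show ?thesis
        unfolding eq by (rule tight_total_investment[OF adms fun_upd_same nash_tight[OF t] k])
    qed
    then have "AE h in play_law t k. \<forall>i. on_course k i h \<and> ?tight i h"
      by (intro AE_all_countable[THEN iffD2] allI)
    then show ?case
    proof (rule AE_mp[OF _ AE_I2[OF impI]], intro allI)
      fix h i assume "h \<in> space (play_law t k)" and "\<forall>i. on_course k i h \<and> ?tight i h"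
      then show "t i (Suc k) h = sigma i (Suc k) h"
        using space_play_law[OF mt less_imp_le[OF k]]
        by (intro investments_determined[OF card adm k]) auto
    qed
  qed
  then show ?thesis by (simp add: agree_in_play_def)
qed

end

theorem theorem4p1:
  fixes n :: nat and w c :: "nat \<Rightarrow> real" and A :: "'p::finite \<Rightarrow> real"
  assumes "n \<ge> 1" and "CARD('p) \<ge> 2"
    and "\<forall>k\<in>{1..n}. w k > 0"
    and "\<forall>k\<in>{1..<n}. c k \<ge> 0" and "c n = 0"
    and "\<forall>i. A i > threshold n w c"
  shows "unique_nash_equilibrium n w c A (sigma_strategy n w c A)
    \<and> (\<forall>i. expected_payoff n w (sigma_strategy n w c A) i
            = A i * tail_payoff n w 1 / (\<Sum>j\<in>UNIV. A j))
    \<and> (\<forall>i s. (\<forall>j. j \<noteq> i \<longrightarrow> admissible n c A j (s j)) \<longrightarrow>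
            expected_payoff n w (s(i := sigma_strategy n w c A i)) i
              \<ge> A i * tail_payoff n w 1 / (\<Sum>j\<in>UNIV. A j))"
proof -
  have c: "0 \<le> c k" if "1 \<le> k" "k \<le> n" for k
    using assms(4,5) that by (cases "k = n") auto
  interpret fee_game n w c A
    using assms c by unfold_locales auto
  have share: "A i * tail_payoff n w 1 / (\<Sum>j\<in>UNIV. A j) = share 1 A i" for i
    by (simp add: share_def mult.commute)
  show ?thesis
    unfolding unique_nash_equilibrium_def share
    using nash_sigma nash_agrees_with_sigma[OF assms(2)] expected_payoff_sigma guarantee
    by blast
qed

end
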